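(* Let $t\geq 1$ be an integer. For every integer $h\geq 0$, every connected graph with treewidth at most $t-1$ has pathwidth at most $th+1$ or belongs to $\mathcal{T}_{h+1}$.
   Context: Graphs are finite, simple and undirected; a graph with no vertices is not connected. The classes $\mathcal{T}_h$ are defined inductively: $\mathcal{T}_0$ is the class of all connected graphs, and $\mathcal{T}_{h+1}$ is the class of connected graphs $G$ that contain three pairwise disjoint vertex sets $V_1,V_2,V_3$ such that $G[V_1],G[V_2],G[V_3]\in\mathcal{T}_h$ and for any two of $V_1,V_2,V_3$ there is a path in $G$ connecting them that avoids the third one. *)

theory Defs
  imports "Graph_Theory.Graph_Theory"
begin

text \<open>
  Finite simple undirected graphs are rendered by the locale predicate \<^const>\<open>graph\<close>: finite
  symmetric digraphs without loops and parallel arcs, in which an edge is a pair of opposite arcs.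
  \<^const>\<open>connected\<close> includes that the vertex set is nonempty.
\<close>

text \<open>
  The library's \<^const>\<open>tree\<close> is not usable for symmetric digraphs: a pair of opposite arcs already
  is a \<^const>\<open>pre_digraph.cycle\<close>. In an undirected graph a cycle has at least three vertices.
\<close>

definition undirected_tree :: "('t, 'e) pre_digraph \<Rightarrow> bool" where
  "undirected_tree T \<longleftrightarrow> graph T \<and> connected T \<and>
     \<not> (\<exists>p. vpath p T \<and> length p \<ge> 3 \<and> last p \<rightarrow>\<^bsub>T\<^esub> hd p)"

definition path_graph :: "('t, 'e) pre_digraph \<Rightarrow> bool" where
  "path_graph T \<longleftrightarrow> graph T \<and>
     (\<exists>xs. xs \<noteq> [] \<and> distinct xs \<and> verts T = set xs \<and>
           arcs_ends T = set (vwalk_arcs xs) \<union> (set (vwalk_arcs xs))\<inverse>)"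

text \<open>
  The connectedness condition includes that every vertex of \<open>G\<close> lies in some bag.
\<close>

definition tree_decomposition ::
    "('a, 'b) pre_digraph \<Rightarrow> ('t, 'e) pre_digraph \<Rightarrow> ('t \<Rightarrow> 'a set) \<Rightarrow> bool" where
  "tree_decomposition G T B \<longleftrightarrow> undirected_tree T \<and>
     (\<forall>x\<in>verts T. B x \<subseteq> verts G) \<and>
     (\<forall>v\<in>verts G. connected (T \<restriction> {x \<in> verts T. v \<in> B x})) \<and>
     (\<forall>u v. u \<rightarrow>\<^bsub>G\<^esub> v \<longrightarrow> (\<exists>x\<in>verts T. u \<in> B x \<and> v \<in> B x))"

definition path_decomposition ::
    "('a, 'b) pre_digraph \<Rightarrow> ('t, 'e) pre_digraph \<Rightarrow> ('t \<Rightarrow> 'a set) \<Rightarrow> bool" where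
  "path_decomposition G T B \<longleftrightarrow> tree_decomposition G T B \<and> path_graph T"

definition decomposition_width :: "('t, 'e) pre_digraph \<Rightarrow> ('t \<Rightarrow> 'a set) \<Rightarrow> int" where
  "decomposition_width T B = int (Max ((\<lambda>x. card (B x)) ` verts T)) - 1"

text \<open>
  Every finite tree is isomorphic to one whose nodes are natural numbers and whose arcs are pairs
  of nodes, so it is enough to minimise over those.
\<close>

definition treewidth :: "('a, 'b) pre_digraph \<Rightarrow> int" where
  "treewidth G = (LEAST w. \<exists>(T :: nat pair_pre_digraph) B.
     tree_decomposition G (with_proj T) B \<and> w = decomposition_width (with_proj T) B)"

definition pathwidth :: "('a, 'b) pre_digraph \<Rightarrow> int" where
  "pathwidth G = (LEAST w. \<exists>(T :: nat pair_pre_digraph) B.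
     path_decomposition G (with_proj T) B \<and> w = decomposition_width (with_proj T) B)"

definition path_avoiding :: "('a, 'b) pre_digraph \<Rightarrow> 'a set \<Rightarrow> 'a set \<Rightarrow> 'a set \<Rightarrow> bool" where
  "path_avoiding G X Y Z \<longleftrightarrow> (\<exists>p. vpath p G \<and> hd p \<in> X \<and> last p \<in> Y \<and> set p \<inter> Z = {})"

primrec T_class :: "nat \<Rightarrow> ('a, 'b) pre_digraph set" where
  "T_class 0 = {G. graph G \<and> connected G}"
| "T_class (Suc h) = {G. graph G \<and> connected G \<and>
     (\<exists>V1 V2 V3. V1 \<subseteq> verts G \<and> V2 \<subseteq> verts G \<and> V3 \<subseteq> verts G \<and>
        V1 \<inter> V2 = {} \<and> V1 \<inter> V3 = {} \<and> V2 \<inter> V3 = {} \<and>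
        G \<restriction> V1 \<in> T_class h \<and> G \<restriction> V2 \<in> T_class h \<and> G \<restriction> V3 \<in> T_class h \<and>
        path_avoiding G V1 V2 V3 \<and> path_avoiding G V1 V3 V2 \<and> path_avoiding G V2 V3 V1)}"

end

theory Submission
  imports Defs
begin

text \<open>
  By induction on \<open>h\<close>. A connected graph that contains no three vertices, any two of them joined by
  a path avoiding the third, is a path, which settles \<open>h = 0\<close>.

  For the induction step, choose among the tree decompositions with bags of size at most \<open>t\<close> one that
  minimises the sum of the squared bag sizes. If the union of the bags on one side of a tree edge were
  disconnected, that side could be replaced by two copies of it, each restricted to one part; as the
  graph is connected, the bag next to the edge meets both parts, so the sum would decrease. Hence both
  sides of every tree edge induce connected subgraphs. Call a branch at a tree node rich if the graph
  induced by its vertices outside the bag of the node contains a connected subgraph of the class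
  for \<open>h + 1\<close>. Three rich branches at one node yield a member of the class for \<open>h + 2\<close>: any two of
  them are joined inside the side of the tree that excludes the third. Otherwise, starting at the
  end of a smallest rich branch and always following the unique rich branch ahead, one obtains a path
  in the tree such that the components left after deleting its bags are not rich. By induction
  they have path decompositions of width at most \<open>t h + 1\<close>; adding to each the bag of the path node it
  is attached to and concatenating increases the bag sizes by at most \<open>t\<close>.
\<close>

section \<open>Connectedness with respect to a relation\<close>

text \<open>A graph is handled as one edge relation \<open>E\<close>, its induced subgraphs as
  vertex sets, so that all of them share \<open>E\<close> and inductions run over sets.\<close>

definition connected_in :: "'a rel \<Rightarrow> 'a set \<Rightarrow> bool" where
  "connected_in E W \<longleftrightarrow> W \<noteq> {} \<and> (\<forall>x\<in>W. \<forall>y\<in>W. (x, y) \<in> (Restr E W)\<^sup>*)"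

text \<open>A walk inside \<open>U\<close> is enough, as it contains a path. Its end lies in
  \<open>U\<close> automatically, because its start and all its steps do.\<close>

definition linked :: "'a rel \<Rightarrow> 'a set \<Rightarrow> 'a set \<Rightarrow> 'a set \<Rightarrow> bool" where
  "linked E U X Y \<longleftrightarrow> (\<exists>x\<in>X \<inter> U. \<exists>y\<in>Y. (x, y) \<in> (Restr E U)\<^sup>*)"

text \<open>The class \<open>P\<close> is a parameter so that the induction step can be carried out
  over an abstract lower level.\<close>

definition tripod :: "'a rel \<Rightarrow> ('a set \<Rightarrow> bool) \<Rightarrow> 'a set \<Rightarrow> bool" where
  "tripod E P W \<longleftrightarrow> (\<exists>V1 V2 V3. V1 \<subseteq> W \<and> V2 \<subseteq> W \<and> V3 \<subseteq> W \<and>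
     V1 \<inter> V2 = {} \<and> V1 \<inter> V3 = {} \<and> V2 \<inter> V3 = {} \<and> P V1 \<and> P V2 \<and> P V3 \<and>
     linked E (W - V3) V1 V2 \<and> linked E (W - V2) V1 V3 \<and> linked E (W - V1) V2 V3)"

primrec ternary :: "'a rel \<Rightarrow> nat \<Rightarrow> 'a set \<Rightarrow> bool" where
  "ternary E 0 W = connected_in E W"
| "ternary E (Suc h) W = (connected_in E W \<and> tripod E (ternary E h) W)"

lemma ternary_connected_in: "ternary E h W \<Longrightarrow> connected_in E W"
  by (cases h) auto

lemma Restr_mono: "U \<subseteq> W \<Longrightarrow> (Restr E U)\<^sup>* \<subseteq> (Restr E W)\<^sup>*"
  by (rule rtrancl_mono) auto

lemma rtrancl_closed:
  assumes "(x, y) \<in> R\<^sup>*" "x \<in> C" "\<And>u v. u \<in> C \<Longrightarrow> (u, v) \<in> R \<Longrightarrow> v \<in> C"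
  shows "y \<in> C"
  using assms(1,2) by (induction rule: rtrancl_induct) (use assms(3) in blast)+

lemma connected_in_closed:
  assumes "connected_in E W" "x \<in> W" "x \<in> C"
    and "\<And>u v. u \<in> C \<Longrightarrow> u \<in> W \<Longrightarrow> v \<in> W \<Longrightarrow> (u, v) \<in> E \<Longrightarrow> v \<in> C"
  shows "W \<subseteq> C"
proof
  fix y assume "y \<in> W"
  then have "(x, y) \<in> (Restr E W)\<^sup>*"
    using assms(1,2) by (auto simp: connected_in_def)
  then show "y \<in> C"
    using assms(3) by (rule rtrancl_closed) (use assms(4) in auto)
qed

lemma sym_Restr_rtrancl:
  "sym E \<Longrightarrow> (x, y) \<in> (Restr E W)\<^sup>* \<Longrightarrow> (y, x) \<in> (Restr E W)\<^sup>*"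
  by (rule symD[OF sym_rtrancl]) (auto simp: sym_def)

lemma connected_in_singleton: "connected_in E {x}"
  by (auto simp: connected_in_def)

lemma connected_inI:
  assumes "sym E" "x \<in> W" "\<And>y. y \<in> W \<Longrightarrow> (x, y) \<in> (Restr E W)\<^sup>*"
  shows "connected_in E W"
  unfolding connected_in_def
proof (intro conjI ballI)
  fix u v assume "u \<in> W" "v \<in> W"
  then show "(u, v) \<in> (Restr E W)\<^sup>*"
    using assms(3) sym_Restr_rtrancl[OF assms(1)] by (meson rtrancl_trans)
qed (use assms(2) in auto)

lemma connected_in_insert:
  assumes "sym E" "connected_in E M" "x \<in> M" "(x, y) \<in> E"
  shows "connected_in E (insert y M)"
proof (rule connected_inI[OF assms(1), of x])
  fix z assume z: "z \<in> insert y M"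
  show "(x, z) \<in> (Restr E (insert y M))\<^sup>*"
  proof (cases "z = y")
    case False
    then have "(x, z) \<in> (Restr E M)\<^sup>*" using z assms by (auto simp: connected_in_def)
    then show ?thesis using Restr_mono[of M "insert y M"] by blast
  qed (use assms in auto)
qed (use assms in auto)

lemma linked_connected_in:
  assumes "connected_in E S" "S \<subseteq> U" "X \<subseteq> S" "Y \<subseteq> S" "X \<noteq> {}" "Y \<noteq> {}"
  shows "linked E U X Y"
  using assms Restr_mono[OF assms(2), of E] unfolding linked_def connected_in_def
  by (meson IntI ex_in_conv subsetD)

lemma component:
  assumes "sym E" "x \<in> W"
  obtains C where "C \<subseteq> W" "x \<in> C" "connected_in E C"
    "\<And>u v. (u, v) \<in> E \<Longrightarrow> u \<in> C \<Longrightarrow> v \<in> W \<Longrightarrow> v \<in> C"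
proof
  let ?C = "{y \<in> W. (x, y) \<in> (Restr E W)\<^sup>*}"
  show "?C \<subseteq> W" "x \<in> ?C" using assms by auto
  show closed: "v \<in> ?C" if "(u, v) \<in> E" "u \<in> ?C" "v \<in> W" for u v
    using that by (auto intro: rtrancl_into_rtrancl)
  \<comment> \<open>Every vertex on a walk from \<open>x\<close> is itself reachable, so the walk
    never leaves \<open>?C\<close>.\<close>
  have *: "(x, y) \<in> (Restr E ?C)\<^sup>*" if "(x, y) \<in> (Restr E W)\<^sup>*" for y
    using that
  proof (induction rule: rtrancl_induct)
    case (step y z)
    then have "(y, z) \<in> Restr E ?C" by (auto intro: rtrancl_into_rtrancl)
    with step show ?case by (meson rtrancl_into_rtrancl)
  qed simp
  then show "connected_in E ?C"
    using assms by (intro connected_inI[of E x]) auto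
qed

section \<open>Path decompositions as lists of bags\<close>

definition covers :: "'a rel \<Rightarrow> 'a set \<Rightarrow> 'a set list \<Rightarrow> bool" where
  "covers E W bs \<longleftrightarrow> (\<forall>u\<in>W. \<forall>v\<in>W. (u, v) \<in> E \<longrightarrow> (\<exists>D\<in>set bs. u \<in> D \<and> v \<in> D))"

text \<open>Local form of the condition that the bags of a vertex form an interval. For the last bag
  the union is empty, so the unspecified \<open>hd []\<close> does no harm.\<close>

fun linear_bags :: "'a set list \<Rightarrow> bool" where
  "linear_bags [] = True"
| "linear_bags (b # bs) \<longleftrightarrow> linear_bags bs \<and> b \<inter> \<Union>(set bs) \<subseteq> hd bs"

text \<open>\<open>k\<close> bounds bag sizes, one more than the width. The empty list decomposes
  the empty set, where concatenation over components can start.\<close>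

definition path_dec :: "'a rel \<Rightarrow> 'a set \<Rightarrow> nat \<Rightarrow> 'a set list \<Rightarrow> bool" where
  "path_dec E W k bs \<longleftrightarrow>
     linear_bags bs \<and> \<Union>(set bs) = W \<and> covers E W bs \<and> (\<forall>D\<in>set bs. card D \<le> k)"

lemma linear_bags_append:
  assumes "linear_bags xs" "linear_bags ys" "\<Union>(set xs) \<inter> \<Union>(set ys) \<subseteq> last xs \<inter> hd ys"
  shows "linear_bags (xs @ ys)"
  using assms
proof (induction xs)
  case (Cons x xs)
  show ?case
  proof (cases xs)
    case Nil
    with Cons show ?thesis by auto
  next
    case (Cons a xs')
    \<comment> \<open>A vertex of \<open>x\<close> that recurs in \<open>ys\<close> lies in
      \<open>last xs\<close>; so it already recurs in \<open>xs\<close> and therefore lies in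
      \<open>hd xs\<close>.\<close>
    have "last xs \<in> set xs" by (simp add: Cons)
    moreover have "last (x # xs) = last xs" "hd (xs @ ys) = hd xs" by (simp_all add: Cons)
    ultimately show ?thesis using Cons.IH Cons.prems by (simp, blast)
  qed
qed simp

text \<open>The last hypothesis excludes edges between \<open>U - W\<close> and
  \<open>W - U\<close>, so every edge lies within one of the two sets.\<close>

lemma path_dec_append:
  assumes "sym E" "path_dec E U k xs" "path_dec E W k ys" "U \<inter> W \<subseteq> last xs \<inter> hd ys"
    and "\<And>u v. (u, v) \<in> E \<Longrightarrow> u \<in> W \<Longrightarrow> v \<in> U \<Longrightarrow> v \<in> W \<or> u \<in> U"
  shows "path_dec E (U \<union> W) k (xs @ ys)"
proof -
  have "covers E (U \<union> W) (xs @ ys)"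
    using assms(2,3,5) symD[OF assms(1)] unfolding covers_def path_dec_def
    by (metis UnE UnI1 UnI2 set_append)
  moreover have "linear_bags (xs @ ys)"
    using assms(2-4) by (intro linear_bags_append) (auto simp: path_dec_def)
  ultimately show ?thesis
    using assms(2,3) by (auto simp: path_dec_def)
qed

lemma linear_bags_map_Un: "linear_bags bs \<Longrightarrow> linear_bags (map ((\<union>) B) bs)"
proof (induction bs)
  case (Cons b bs)
  then show ?case by (cases bs) auto
qed simp

section \<open>Graphs without a tripod of vertices\<close>

lemma tripod_vertices:
  assumes "connected_in E W" "a \<in> W" "b \<in> W" "c \<in> W" "a \<noteq> b" "a \<noteq> c" "b \<noteq> c"
    and "(a, b) \<in> (Restr E (W - {c}))\<^sup>*" "(a, c) \<in> (Restr E (W - {b}))\<^sup>*"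
    and "(b, c) \<in> (Restr E (W - {a}))\<^sup>*"
  shows "ternary E 1 W"
proof -
  have "tripod E (ternary E 0) W"
    unfolding tripod_def
    by (rule exI[of _ "{a}"], rule exI[of _ "{b}"], rule exI[of _ "{c}"])
      (use assms in \<open>auto simp: linked_def connected_in_singleton\<close>)
  with assms(1) show ?thesis by simp
qed

text \<open>The standard path decomposition of a path: one bag per edge, or a singleton if there is
  only one vertex.\<close>

fun edge_bags :: "'a list \<Rightarrow> 'a set list" where
  "edge_bags [] = []"
| "edge_bags [x] = [{x}]"
| "edge_bags (x # y # xs) = {x, y} # edge_bags (y # xs)"

lemma Union_edge_bags: "\<Union>(set (edge_bags xs)) = set xs"
  by (induction xs rule: edge_bags.induct) auto

lemma hd_edge_bags: "x \<in> hd (edge_bags (x # xs))"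
  by (cases xs) auto

lemma linear_edge_bags: "distinct xs \<Longrightarrow> linear_bags (edge_bags xs)"
proof (induction xs rule: edge_bags.induct)
  case (3 x y xs)
  then show ?case
    using hd_edge_bags[of y xs] Union_edge_bags[of "y # xs"] by auto
qed auto

lemma card_edge_bags: "D \<in> set (edge_bags xs) \<Longrightarrow> card D \<le> 2"
  by (induction xs rule: edge_bags.induct) (auto simp: card_insert_if)

lemma edge_bags_nth: "Suc i < length xs \<Longrightarrow> {xs ! i, xs ! Suc i} \<in> set (edge_bags xs)"
proof (induction xs arbitrary: i rule: edge_bags.induct)
  case (3 x y xs)
  then show ?case by (cases i) auto
qed auto

lemma successively_rtrancl:
  assumes "successively (\<lambda>a b. (a, b) \<in> E) xs" "i \<le> j" "j < length xs"
    and "\<And>l. i \<le> l \<Longrightarrow> l \<le> j \<Longrightarrow> xs ! l \<in> U"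
  shows "(xs ! i, xs ! j) \<in> (Restr E U)\<^sup>*"
  using assms(2-4)
proof (induction j rule: dec_induct)
  case (step n)
  have "(xs ! n, xs ! Suc n) \<in> E"
    using assms(1) step.prems by (simp add: successively_conv_nth)
  moreover have "xs ! n \<in> U" "xs ! Suc n \<in> U" using step by auto
  moreover have "(xs ! i, xs ! n) \<in> (Restr E U)\<^sup>*" using step by simp
  ultimately show ?case by (meson IntI SigmaI rtrancl_into_rtrancl)
qed simp

text \<open>A longest path is induced and spanning: a chord or an additional neighbour of the path
  would close a cycle or create a vertex of degree three.\<close>

lemma path_dec_without_tripod:
  assumes "sym E" "finite W" "connected_in E W" "\<not> ternary E 1 W"
  shows "\<exists>bs. path_dec E W 2 bs"
proof -
  \<comment> \<open>\<open>Q\<close> singles out the vertex lists of paths in \<open>W\<close>;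
    their length is at most \<open>card W\<close>, so a longest one exists.\<close>
  define Q where "Q = (\<lambda>xs. xs \<noteq> [] \<and> distinct xs \<and> set xs \<subseteq> W \<and> successively (\<lambda>a b. (a, b) \<in> E) xs)"
  obtain w where "w \<in> W" using assms(3) by (auto simp: connected_in_def)
  then have "Q [w]" by (simp add: Q_def)
  moreover have "length ys \<le> card W" if "Q ys" for ys
    using that assms(2) by (metis Q_def card_mono distinct_card)
  ultimately obtain xs where xs: "Q xs" and longest: "\<And>ys. Q ys \<Longrightarrow> length ys \<le> length xs"
    using ex_has_greatest_nat[of Q "[w]" length "Suc (card W)"] by (metis less_Suc_eq_le)
  have E: "(a, b) \<in> E \<longleftrightarrow> (b, a) \<in> E" for a b using assms(1) by (auto simp: sym_def)
  have ne: "xs \<noteq> []" and dist: "distinct xs" and sub: "set xs \<subseteq> W"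
    and succ: "successively (\<lambda>a b. (a, b) \<in> E) xs"
    using xs by (auto simp: Q_def)
  have adj: "(xs ! i, xs ! Suc i) \<in> E" if "Suc i < length xs" for i
    using succ that by (simp add: successively_conv_nth)
  have inW: "xs ! i \<in> W" if "i < length xs" for i using sub that by auto
  have "v \<in> set xs" if uv: "(u, v) \<in> E" "u \<in> set xs" "v \<in> W" for u v
  proof (rule ccontr)
    assume v: "v \<notin> set xs"
    obtain i where i: "i < length xs" "u = xs ! i" using uv(2) by (auto simp: in_set_conv_nth)
    have "i \<noteq> 0"
    proof
      assume "i = 0"
      then have "Q (v # xs)"
        using xs uv v i E by (cases xs) (auto simp: Q_def)
      with longest show False by fastforce
    qed
    moreover have "Suc i \<noteq> length xs"
    proof
      assume "Suc i = length xs"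
      then have "last xs = u" using i ne by (metis diff_Suc_1 last_conv_nth)
      then have "Q (xs @ [v])"
        using xs uv v by (auto simp: Q_def successively_append_iff)
      with longest show False by fastforce
    qed
    ultimately obtain j where j: "i = Suc j" "Suc (Suc j) < length xs"
      using i by (metis Suc_lessI not0_implies_Suc)
    \<comment> \<open>The inner vertex \<open>u\<close> has a neighbour off the path: any two of
      \<open>?a\<close>, \<open>?b\<close>, \<open>v\<close> are joined through
      \<open>u\<close>.\<close>
    let ?a = "xs ! j" and ?b = "xs ! Suc (Suc j)"
    have d: "?a \<noteq> ?b" "?a \<noteq> u" "?b \<noteq> u" "v \<noteq> ?a" "v \<noteq> ?b" "v \<noteq> u"
      using dist v j i uv(2) by (auto simp: nth_eq_iff_index_eq)
    have e: "(?a, u) \<in> E" "(u, ?b) \<in> E" "(u, v) \<in> E" "(v, u) \<in> E" "(?b, u) \<in> E"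
      using adj[of j] adj[of "Suc j"] j i uv E by auto
    have m: "?a \<in> W" "?b \<in> W" "u \<in> W" "v \<in> W" using inW j i uv sub by auto
    have "ternary E 1 W"
    proof (rule tripod_vertices[of E W ?a ?b v])
      show "(?a, ?b) \<in> (Restr E (W - {v}))\<^sup>*"
        by (rule rtrancl_trans[of _ u]; rule r_into_rtrancl) (use d e m in auto)
      show "(?a, v) \<in> (Restr E (W - {?b}))\<^sup>*"
        by (rule rtrancl_trans[of _ u]; rule r_into_rtrancl) (use d e m in auto)
      show "(?b, v) \<in> (Restr E (W - {?a}))\<^sup>*"
        by (rule rtrancl_trans[of _ u]; rule r_into_rtrancl) (use d e m in auto)
    qed (use d m assms(3) in auto)
    with assms(4) show False ..
  qed
  moreover have "hd xs \<in> set xs" using ne by simp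
  ultimately have W: "W = set xs"
    using connected_in_closed[OF assms(3), of "hd xs" "set xs"] sub by blast
  have chord: "j \<le> Suc i" if ij: "(xs ! i, xs ! j) \<in> E" "i < length xs" "j < length xs" for i j
  proof (rule ccontr)
    assume "\<not> j \<le> Suc i"
    then have lt: "Suc i < j" by simp
    \<comment> \<open>\<open>?a\<close> and \<open>?b\<close> are adjacent on the path, the chord
      joins \<open>?a\<close> to \<open>?c\<close>, and the path from \<open>?b\<close> on to
      \<open>?c\<close> avoids \<open>?a\<close>.\<close>
    let ?a = "xs ! i" and ?b = "xs ! Suc i" and ?c = "xs ! j"
    have d: "?a \<noteq> ?b" "?a \<noteq> ?c" "?b \<noteq> ?c"
      using dist ij lt by (auto simp: nth_eq_iff_index_eq)
    have "ternary E 1 W"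
    proof (rule tripod_vertices[of E W ?a ?b ?c])
      show "(?a, ?b) \<in> (Restr E (W - {?c}))\<^sup>*"
        by (rule r_into_rtrancl) (use d adj inW ij lt in auto)
      show "(?a, ?c) \<in> (Restr E (W - {?b}))\<^sup>*"
        by (rule r_into_rtrancl) (use d inW ij lt in auto)
      show "(?b, ?c) \<in> (Restr E (W - {?a}))\<^sup>*"
        by (rule successively_rtrancl[OF succ])
          (use lt ij dist inW in \<open>auto simp: nth_eq_iff_index_eq\<close>)
    qed (use d assms(3) inW ij lt in auto)
    with assms(4) show False ..
  qed
  have *: "\<exists>D\<in>set (edge_bags xs). xs ! i \<in> D \<and> xs ! j \<in> D"
    if ij: "(xs ! i, xs ! j) \<in> E" "j < length xs" "i \<le> j" for i j
  proof (cases "i = j")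
    \<comment> \<open>\<open>E\<close> is only assumed symmetric, so it may have loops.\<close>
    case True
    have "xs ! j \<in> \<Union>(set (edge_bags xs))" using ij by (simp add: Union_edge_bags)
    with True show ?thesis by auto
  next
    case False
    then have "j = Suc i" using chord[of i j] ij by auto
    then show ?thesis using edge_bags_nth[of i xs] ij by blast
  qed
  have "covers E W (edge_bags xs)"
    unfolding covers_def
  proof (intro ballI impI)
    fix u v assume uv: "u \<in> W" "v \<in> W" "(u, v) \<in> E"
    then obtain i j where ij: "i < length xs" "u = xs ! i" "j < length xs" "v = xs ! j"
      unfolding W by (metis in_set_conv_nth)
    then show "\<exists>D\<in>set (edge_bags xs). u \<in> D \<and> v \<in> D"
      using *[of i j] *[of j i] uv E by (metis nle_le)
  qed
  then have "path_dec E W 2 (edge_bags xs)"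
    using dist W by (auto simp: path_dec_def linear_edge_bags Union_edge_bags card_edge_bags)
  then show ?thesis ..
qed

section \<open>Tree decompositions as rooted trees of bags\<close>

text \<open>A tree decomposition with an arbitrary root and an arbitrary order of children. The
  lemmas on rerooting and on permuting children make both choices immaterial.\<close>

datatype 'a bag_tree = Node (root: "'a set") (children: "'a bag_tree list")

primrec bags :: "'a bag_tree \<Rightarrow> 'a set list" where
  "bags (Node B ts) = B # concat (map bags ts)"

definition vs :: "'a bag_tree \<Rightarrow> 'a set" where
  "vs R = \<Union>(set (bags R))"

text \<open>
  The rooted form of the requirement that the nodes whose bags contain a given vertex form a subtree.
\<close>

fun consistent :: "'a bag_tree \<Rightarrow> bool" where
  "consistent (Node B ts) \<longleftrightarrow> (\<forall>s\<in>set ts. consistent s \<and> vs s \<inter> B \<subseteq> root s) \<and>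
     sorted_wrt (\<lambda>s s'. vs s \<inter> vs s' \<subseteq> B) ts"

definition tree_dec :: "'a rel \<Rightarrow> 'a set \<Rightarrow> nat \<Rightarrow> 'a bag_tree \<Rightarrow> bool" where
  "tree_dec E W t R \<longleftrightarrow>
     consistent R \<and> vs R = W \<and> covers E W (bags R) \<and> (\<forall>D\<in>set (bags R). card D \<le> t)"

lemma vs_Node [simp]: "vs (Node B ts) = B \<union> (\<Union>s\<in>set ts. vs s)"
  by (auto simp: vs_def)

section \<open>Permuting children, moving the root, and separation by a bag\<close>

lemma sorted_wrt_symmetric_mset:
  assumes "mset xs = mset ys" "sorted_wrt P ys" "\<And>x y. P x y \<Longrightarrow> P y x"
  shows "sorted_wrt P xs"
  using assms(1,2)
proof (induction xs arbitrary: ys)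
  case (Cons x xs)
  then obtain us zs where ys: "ys = us @ x # zs"
    by (metis list.set_intros(1) set_mset_mset split_list)
  then have eq: "mset xs = mset (us @ zs)" using Cons.prems by simp
  moreover have "sorted_wrt P (us @ zs)" using Cons.prems ys by (simp add: sorted_wrt_append)
  ultimately have "sorted_wrt P xs" by (rule Cons.IH)
  moreover have "set xs = set (us @ zs)" using eq by (metis set_mset_mset)
  ultimately show ?case
    using Cons.prems(2) ys assms(3) by (auto simp: sorted_wrt_append)
qed simp

lemma consistent_mset:
  assumes "consistent (Node B ts)" "mset ts' = mset ts"
  shows "consistent (Node B ts')"
proof -
  have "set ts' = set ts" using assms(2) by (metis set_mset_mset)
  then show ?thesis
    using assms sorted_wrt_symmetric_mset[OF assms(2), of "\<lambda>s s'. vs s \<inter> vs s' \<subseteq> B"] by auto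
qed

lemma tree_dec_mset:
  assumes "tree_dec E W t (Node B ts)" "mset ts' = mset ts"
  shows "tree_dec E W t (Node B ts')"
proof -
  have "set ts' = set ts" using assms(2) by (metis set_mset_mset)
  moreover from this have "set (bags (Node B ts')) = set (bags (Node B ts))" by simp
  ultimately show ?thesis
    using assms consistent_mset[of B ts ts'] by (simp add: tree_dec_def covers_def vs_def)
qed

text \<open>Moves the root across the edge to its first child; the old root becomes a child carrying
  the remaining subtrees.\<close>

lemma consistent_reroot:
  assumes "consistent (Node B (Node C cs # ts))"
  shows "consistent (Node C (Node B ts # cs))"
proof -
  have ts: "vs (Node C cs) \<inter> B \<subseteq> C" "\<forall>s\<in>set ts. vs s \<inter> B \<subseteq> root s"
    "\<forall>s\<in>set ts. vs (Node C cs) \<inter> vs s \<subseteq> B" and cs: "\<forall>s\<in>set cs. vs s \<inter> C \<subseteq> root s"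
    using assms by (auto simp del: vs_Node)
  \<comment> \<open>A vertex occurring on both sides of the edge lies in both end bags; this is all
    that the reversed edge demands.\<close>
  have "vs (Node B ts) \<inter> vs (Node C cs) \<subseteq> B \<inter> C"
    using ts(1,3) by auto
  moreover have "C \<subseteq> vs (Node C cs)" "\<And>s. s \<in> set cs \<Longrightarrow> vs s \<subseteq> vs (Node C cs)" by auto
  ultimately have "vs (Node B ts) \<inter> C \<subseteq> B" "\<forall>s\<in>set cs. vs (Node B ts) \<inter> vs s \<subseteq> C"
    by blast+
  with assms cs show ?thesis by (simp del: vs_Node)
qed

lemma tree_dec_reroot:
  assumes "tree_dec E W t (Node B (Node C cs # ts))"
  shows "tree_dec E W t (Node C (Node B ts # cs))"
proof -
  have "set (bags (Node C (Node B ts # cs))) = set (bags (Node B (Node C cs # ts)))" by auto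
  with assms show ?thesis
    using consistent_reroot[of B C cs ts] by (simp add: tree_dec_def covers_def vs_def)
qed

text \<open>A bag covering the edge contains \<open>u\<close>, so it is not the root bag; if it lay
  below another child, \<open>u\<close> would be in \<open>B\<close>.\<close>

lemma tree_dec_neighbour:
  assumes "tree_dec E W t (Node B ts)" "c \<in> set ts" "u \<in> vs c" "u \<notin> B" "(u, v) \<in> E" "v \<in> W"
  shows "v \<in> vs c"
proof -
  obtain xs ys where ts: "ts = xs @ c # ys" using assms(2) by (meson split_list)
  have W: "W = vs (Node B ts)" using assms(1) by (simp add: tree_dec_def)
  then have "u \<in> W" using assms(2,3) by auto
  then obtain D where D: "D \<in> set (bags (Node B ts))" "u \<in> D" "v \<in> D"
    using assms(1,5,6) unfolding tree_dec_def covers_def by metis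
  then obtain d where d: "d \<in> set ts" "D \<in> set (bags d)" using assms(4) by auto
  have "u \<in> vs d" using d D by (auto simp: vs_def)
  moreover have "vs c \<inter> vs d \<subseteq> B" if "d \<in> set (xs @ ys)"
    using assms(1) that by (auto simp: tree_dec_def ts sorted_wrt_append)
  ultimately have "d = c" using d assms(3,4) ts by auto
  then show ?thesis using d D by (auto simp: vs_def)
qed

subsection \<open>Restriction to a set of vertices\<close>

text \<open>The shape is kept and bags may become empty. This serves to pass to induced subgraphs in
  the induction on \<open>h\<close> and to make the two copies when a side is split.\<close>

primrec restrict_tree :: "'a set \<Rightarrow> 'a bag_tree \<Rightarrow> 'a bag_tree" where
  "restrict_tree X (Node B ts) = Node (X \<inter> B) (map (restrict_tree X) ts)"

lemma bags_restrict: "bags (restrict_tree X R) = map ((\<inter>) X) (bags R)"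
proof (induction R)
  case (Node B ts)
  then have "map (bags \<circ> restrict_tree X) ts = map (map ((\<inter>) X) \<circ> bags) ts" by simp
  then have "concat (map (bags \<circ> restrict_tree X) ts) = map ((\<inter>) X) (concat (map bags ts))"
    by (simp only: map_concat map_map)
  then show ?case by simp
qed

lemma vs_restrict [simp]: "vs (restrict_tree X R) = X \<inter> vs R"
  by (auto simp: vs_def bags_restrict)

lemma root_restrict [simp]: "root (restrict_tree X R) = X \<inter> root R"
  by (cases R) simp

lemma consistent_restrict: "consistent R \<Longrightarrow> consistent (restrict_tree X R)"
proof (induction R)
  case (Node B ts)
  have "sorted_wrt (\<lambda>s s'. X \<inter> vs s \<inter> (X \<inter> vs s') \<subseteq> X \<inter> B) ts"
    by (rule sorted_wrt_mono_rel[of _ "\<lambda>s s'. vs s \<inter> vs s' \<subseteq> B"]) (use Node.prems in auto)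
  with Node show ?case by (auto simp: sorted_wrt_map)
qed

lemma tree_dec_restrict:
  assumes "tree_dec E W t R" "finite W" "X \<subseteq> W"
  shows "tree_dec E X t (restrict_tree X R)"
proof -
  have "card (X \<inter> D) \<le> t" if "D \<in> set (bags R)" for D
  proof -
    have "D \<subseteq> W" using assms(1) that by (auto simp: tree_dec_def vs_def)
    then have "card (X \<inter> D) \<le> card D" using assms(2) by (meson Int_lower2 card_mono finite_subset)
    then show ?thesis using assms(1) that by (force simp: tree_dec_def)
  qed
  moreover have "covers E X (bags (restrict_tree X R))"
    unfolding covers_def
  proof (intro ballI impI)
    fix u v assume uv: "u \<in> X" "v \<in> X" "(u, v) \<in> E"
    then obtain D where "D \<in> set (bags R)" "u \<in> D" "v \<in> D"
      using assms(1,3) unfolding tree_dec_def covers_def by (meson subsetD)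
    with uv show "\<exists>D\<in>set (bags (restrict_tree X R)). u \<in> D \<and> v \<in> D"
      by (intro bexI[of _ "X \<inter> D"]) (auto simp: bags_restrict)
  qed
  ultimately show ?thesis
    using assms by (auto simp: tree_dec_def consistent_restrict bags_restrict)
qed

subsection \<open>Tree decompositions minimising the sum of the squared bag sizes\<close>

text \<open>Squares make splitting a bag into two nonempty parts profitable; the plain sum of the
  sizes would not change. Empty bags cost nothing.\<close>

definition weight :: "'a bag_tree \<Rightarrow> nat" where
  "weight R = (\<Sum>D\<leftarrow>bags R. (card D)\<^sup>2)"

definition min_tree_dec :: "'a rel \<Rightarrow> 'a set \<Rightarrow> nat \<Rightarrow> 'a bag_tree \<Rightarrow> bool" where
  "min_tree_dec E W t R \<longleftrightarrow>
     tree_dec E W t R \<and> (\<forall>R'. tree_dec E W t R' \<longrightarrow> weight R \<le> weight R')"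

lemma weight_Node: "weight (Node B ts) = (card B)\<^sup>2 + (\<Sum>s\<leftarrow>ts. weight s)"
proof -
  have "(\<Sum>D\<leftarrow>concat (map bags ts). (card D)\<^sup>2) = (\<Sum>s\<leftarrow>ts. weight s)"
    by (induction ts) (auto simp: weight_def)
  then show ?thesis by (simp add: weight_def)
qed

lemma min_tree_dec_mset:
  assumes "min_tree_dec E W t (Node B ts)" "mset ts' = mset ts"
  shows "min_tree_dec E W t (Node B ts')"
proof -
  have "(\<Sum>s\<leftarrow>ts'. weight s) = (\<Sum>s\<leftarrow>ts. weight s)"
    by (metis assms(2) mset_map sum_mset_sum_list)
  then show ?thesis
    using assms tree_dec_mset by (fastforce simp: min_tree_dec_def weight_Node)
qed

lemma min_tree_dec_reroot:
  assumes "min_tree_dec E W t (Node B (Node C cs # ts))"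
  shows "min_tree_dec E W t (Node C (Node B ts # cs))"
proof -
  have "weight (Node C (Node B ts # cs)) = weight (Node B (Node C cs # ts))"
    by (simp add: weight_Node)
  then show ?thesis using assms tree_dec_reroot by (fastforce simp: min_tree_dec_def)
qed

text \<open>No bag weighs less than its two parts together, and in the root bag, where both parts
  are nonempty, the mixed term of the binomial square makes the inequality strict.\<close>

lemma weight_split:
  assumes "finite (vs s)" "C \<inter> C' = {}" "root s \<inter> C \<noteq> {}" "root s \<inter> C' \<noteq> {}"
  shows "weight (restrict_tree C s) + weight (restrict_tree C' s) < weight s"
proof -
  have fin: "finite D" if "D \<in> set (bags s)" for D
    using assms(1) that by (auto simp: vs_def intro: finite_subset)
  have card_le: "card (C \<inter> D) + card (C' \<inter> D) \<le> card D" if "finite D" for D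
  proof -
    have "card (C \<inter> D) + card (C' \<inter> D) = card ((C \<inter> D) \<union> (C' \<inter> D))"
      using assms(2) that by (subst card_Un_disjoint) auto
    also have "\<dots> \<le> card D" using that by (intro card_mono) auto
    finally show ?thesis .
  qed
  have le: "(card (C \<inter> D))\<^sup>2 + (card (C' \<inter> D))\<^sup>2 \<le> (card D)\<^sup>2" if "finite D" for D
    using power_mono[OF card_le[OF that], of 2] by (simp add: power2_sum)
  obtain B ts where s: "s = Node B ts" by (cases s)
  have B: "finite B" using fin s by simp
  have "0 < card (C \<inter> B)" "0 < card (C' \<inter> B)"
    using assms(3,4) B s by (auto simp: card_gt_0_iff)
  then have "0 < 2 * card (C \<inter> B) * card (C' \<inter> B)" by simp
  then have lt: "(card (C \<inter> B))\<^sup>2 + (card (C' \<inter> B))\<^sup>2 < (card B)\<^sup>2"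
    using power_mono[OF card_le[OF B], of 2] unfolding power2_sum by linarith
  have w: "weight (restrict_tree X s) = (card (X \<inter> B))\<^sup>2
      + (\<Sum>D\<leftarrow>concat (map bags ts). (card (X \<inter> D))\<^sup>2)" for X
    unfolding weight_def bags_restrict by (simp add: s comp_def)
  have "(\<Sum>D\<leftarrow>concat (map bags ts). (card (C \<inter> D))\<^sup>2 + (card (C' \<inter> D))\<^sup>2)
      \<le> (\<Sum>D\<leftarrow>concat (map bags ts). (card D)\<^sup>2)"
    by (rule sum_list_mono, rule le, rule fin) (auto simp: s)
  then show ?thesis
    using lt unfolding w by (simp add: sum_list_addf weight_def s)
qed

text \<open>Exchange argument: with \<open>C\<close> a component of \<open>vs s\<close> and
  \<open>C'\<close> the rest, replacing \<open>s\<close> by its restrictions to \<open>C\<close> and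
  \<open>C'\<close> would give a lighter decomposition.\<close>

lemma min_tree_dec_connected:
  assumes "sym E" "finite W" "connected_in E W" "min_tree_dec E W t (Node B (s # ts))" "vs s \<noteq> {}"
  shows "connected_in E (vs s)"
proof (rule ccontr)
  assume disconnected: "\<not> connected_in E (vs s)"
  obtain x where "x \<in> vs s" using assms(5) by auto
  from component[OF assms(1) this] obtain C where
    C: "C \<subseteq> vs s" "x \<in> C" "connected_in E C"
    and closed: "\<And>u v. (u, v) \<in> E \<Longrightarrow> u \<in> C \<Longrightarrow> v \<in> vs s \<Longrightarrow> v \<in> C" by metis
  define C' where "C' = vs s - C"
  have "C' \<noteq> {}" using C disconnected C'_def by auto
  have closed': "v \<in> C'" if "(u, v) \<in> E" "u \<in> C'" "v \<in> vs s" for u v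
    using that closed[of v u] symD[OF assms(1)] by (auto simp: C'_def)
  have dec: "tree_dec E W t (Node B (s # ts))"
    using assms(4) by (simp add: min_tree_dec_def)
  then have W: "W = B \<union> vs s \<union> (\<Union>s\<in>set ts. vs s)" by (simp add: tree_dec_def Un_assoc)
  have sB: "vs s \<inter> B \<subseteq> root s" using dec by (simp add: tree_dec_def)
  \<comment> \<open>If \<open>X\<close> missed \<open>root s\<close>, it would also miss
    \<open>B\<close>; then no edge could leave \<open>X\<close>, against the connectedness of
    \<open>W\<close>.\<close>
  have meets: "root s \<inter> X \<noteq> {}"
    if "X \<subseteq> vs s" "y \<in> X" "z \<in> vs s - X" "\<And>u v. (u, v) \<in> E \<Longrightarrow> u \<in> X \<Longrightarrow> v \<in> vs s \<Longrightarrow> v \<in> X" for X y z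
  proof
    assume "root s \<inter> X = {}"
    have "W \<subseteq> X"
    proof (rule connected_in_closed[OF assms(3)])
      show "y \<in> W" "y \<in> X" using that(1,2) W by auto
      fix u v assume uv: "u \<in> X" "u \<in> W" "v \<in> W" "(u, v) \<in> E"
      then have "u \<in> vs s" "u \<notin> B" using that(1) sB \<open>root s \<inter> X = {}\<close> by auto
      then have "v \<in> vs s" using tree_dec_neighbour[OF dec, of s] uv by simp
      then show "v \<in> X" using that(4) uv by blast
    qed
    then show False using that(3) W by auto
  qed
  have "root s \<inter> C \<noteq> {}" using meets[of C x] C closed \<open>C' \<noteq> {}\<close> by (auto simp: C'_def)
  moreover have "root s \<inter> C' \<noteq> {}" using meets[of C' _ x] C closed' \<open>C' \<noteq> {}\<close> by (auto simp: C'_def)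
  moreover have "finite (vs s)" using assms(2) W by (metis finite_Un)
  ultimately have "weight (restrict_tree C s) + weight (restrict_tree C' s) < weight s"
    by (intro weight_split) (auto simp: C'_def)
  then have less: "weight (Node B (restrict_tree C s # restrict_tree C' s # ts))
      < weight (Node B (s # ts))"
    by (simp add: weight_Node)
  let ?R = "Node B (restrict_tree C s # restrict_tree C' s # ts)"
  have CC': "C \<union> C' = vs s" "C \<inter> C' = {}" using C by (auto simp: C'_def)
  have "tree_dec E W t ?R"
    unfolding tree_dec_def
  proof (intro conjI ballI)
    show "consistent ?R"
      using dec CC' by (auto simp: tree_dec_def consistent_restrict)
    show "vs ?R = W" using W CC' by auto
    show "covers E W (bags ?R)"
      unfolding covers_def
    proof (intro ballI impI)
      fix u v assume uv: "u \<in> W" "v \<in> W" "(u, v) \<in> E"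
      then obtain D where D: "D \<in> set (bags (Node B (s # ts)))" "u \<in> D" "v \<in> D"
        using dec unfolding tree_dec_def covers_def by metis
      show "\<exists>D\<in>set (bags ?R). u \<in> D \<and> v \<in> D"
      proof (cases "D \<in> set (bags s)")
        case True
        then have "u \<in> vs s" "v \<in> vs s" using D by (auto simp: vs_def)
        \<comment> \<open>No edge joins \<open>C\<close> to \<open>C'\<close>, so the edge survives
          in one of the two copies of its bag.\<close>
        then have "u \<in> C \<and> v \<in> C \<or> u \<in> C' \<and> v \<in> C'"
          using closed closed' uv CC' by blast
        then show ?thesis using True D by (auto simp: bags_restrict)
      next
        case False
        then show ?thesis using D by auto
      qed
    qed
    fix D assume "D \<in> set (bags ?R)"
    then obtain D' where D': "D' \<in> set (bags (Node B (s # ts)))" "D \<subseteq> D'"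
      by (auto simp: bags_restrict)
    moreover have "D' \<subseteq> W" using D' dec by (auto simp: tree_dec_def vs_def)
    ultimately have "card D \<le> card D'" using assms(2) by (meson card_mono finite_subset)
    also have "\<dots> \<le> t" using D' dec by (auto simp: tree_dec_def)
    finally show "card D \<le> t" .
  qed
  then show False using assms(4) less by (fastforce simp: min_tree_dec_def)
qed

text \<open>After rerooting across the edge, the parent side is the subtree of a child.\<close>

lemma min_tree_dec_connected_parent:
  assumes "sym E" "finite W" "connected_in E W" "min_tree_dec E W t (Node B (s # ts))"
    "vs (Node B ts) \<noteq> {}"
  shows "connected_in E (vs (Node B ts))"
  using min_tree_dec_connected[OF assms(1-3) _ assms(5)] min_tree_dec_reroot[of E W t B]
    assms(4) by (metis bag_tree.exhaust)

section \<open>Path decompositions along a path of bags\<close>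

text \<open>\<open>contains P (vs s - B)\<close> expresses that the branch \<open>s\<close> at a
  node with bag \<open>B\<close> is rich.\<close>

definition contains :: "('a set \<Rightarrow> bool) \<Rightarrow> 'a set \<Rightarrow> bool" where
  "contains P W \<longleftrightarrow> (\<exists>C\<subseteq>W. P C)"

lemma contains_mono: "contains P U \<Longrightarrow> U \<subseteq> W \<Longrightarrow> contains P W"
  unfolding contains_def by blast

text \<open>The setting of the induction step: \<open>P\<close> is the class one level below,
  \<open>P_free\<close> the induction hypothesis with bag size \<open>k\<close>, and
  \<open>no_tripod\<close> says that \<open>V\<close> is not in the next class.\<close>

locale tripod_free =
  fixes E :: "'a rel" and V :: "'a set" and t k :: nat and P :: "'a set \<Rightarrow> bool"
  assumes sym: "sym E" and finite: "finite V" and conn: "connected_in E V"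
    and P_nonempty: "\<And>C. P C \<Longrightarrow> C \<noteq> {}"
    and P_free: "\<And>C. C \<subseteq> V \<Longrightarrow> connected_in E C \<Longrightarrow> \<not> P C \<Longrightarrow> \<exists>bs. path_dec E C k bs"
    and no_tripod: "\<not> tripod E P V"
begin

abbreviation min_dec :: "'a bag_tree \<Rightarrow> bool" where
  "min_dec \<equiv> min_tree_dec E V t"

section \<open>Path decompositions around a single node\<close>

lemma min_dec_tree_dec: "min_dec R \<Longrightarrow> tree_dec E V t R"
  by (simp add: min_tree_dec_def)

text \<open>The components are connected and not in \<open>P\<close>. Their decompositions can be
  concatenated, as different components share no vertices and no edges run between them.\<close>

lemma path_dec_not_contains:
  assumes "W \<subseteq> V" "\<not> contains P W"
  shows "\<exists>bs. path_dec E W k bs"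
proof -
  have "finite W" using assms(1) finite finite_subset by auto
  then show ?thesis using assms
  proof (induction W rule: finite_psubset_induct)
    case (psubset W)
    show ?case
    proof (cases "W = {}")
      case True
      then have "path_dec E W k []" by (simp add: path_dec_def covers_def)
      then show ?thesis ..
    next
      case False
      then obtain x where "x \<in> W" by auto
      from component[OF sym this] obtain C where C: "C \<subseteq> W" "x \<in> C" "connected_in E C"
        and closed: "\<And>u v. (u, v) \<in> E \<Longrightarrow> u \<in> C \<Longrightarrow> v \<in> W \<Longrightarrow> v \<in> C" by metis
      have "\<not> P C" using psubset.prems(2) C(1) by (auto simp: contains_def)
      then obtain xs where xs: "path_dec E C k xs"
        using P_free[of C] C psubset.prems(1) by blast
      have "\<not> contains P (W - C)" using psubset.prems(2) contains_mono[of P "W - C" W] by blast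
      then obtain ys where ys: "path_dec E (W - C) k ys"
        using psubset.IH[of "W - C"] psubset.prems(1) C by blast
      have "path_dec E (C \<union> (W - C)) k (xs @ ys)"
        using path_dec_append[OF sym xs ys] closed C symD[OF sym] by blast
      then show ?thesis using C by (metis Un_Diff_cancel Un_absorb1)
    qed
  qed
qed

text \<open>\<open>as\<close> holds the children left out or already treated. Keeping the whole node
  in the hypothesis makes the separation by \<open>B\<close> available throughout the
  induction.\<close>

lemma path_dec_below:
  assumes "tree_dec E V t (Node B (as @ cs))" "\<forall>c\<in>set cs. \<not> contains P (vs c - B)"
  shows "\<exists>bs. path_dec E ((\<Union>c\<in>set cs. vs c) - B) k bs"
  using assms
proof (induction cs arbitrary: as)
  case Nil
  have "path_dec E {} k []" by (simp add: path_dec_def covers_def)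
  then show ?case by auto
next
  case (Cons c cs)
  have V: "V = vs (Node B (as @ c # cs))" using Cons.prems(1) by (simp add: tree_dec_def)
  obtain xs where xs: "path_dec E (vs c - B) k xs"
    using path_dec_not_contains[of "vs c - B"] Cons.prems(2) V by auto
  obtain ys where ys: "path_dec E ((\<Union>c\<in>set cs. vs c) - B) k ys"
    using Cons.IH[of "as @ [c]"] Cons.prems by auto
  have disj: "vs c \<inter> vs d \<subseteq> B" if "d \<in> set cs" for d
    using Cons.prems(1) that by (auto simp: tree_dec_def sorted_wrt_append)
  have "path_dec E ((vs c - B) \<union> ((\<Union>c\<in>set cs. vs c) - B)) k (xs @ ys)"
  proof (rule path_dec_append[OF sym xs ys])
    show "(vs c - B) \<inter> ((\<Union>c\<in>set cs. vs c) - B) \<subseteq> last xs \<inter> hd ys"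
      using disj by blast
    fix u v assume uv: "(u, v) \<in> E" "u \<in> (\<Union>c\<in>set cs. vs c) - B" "v \<in> vs c - B"
    then have "u \<in> V" "(v, u) \<in> E" using V symD[OF sym] by auto
    then have "u \<in> vs c" using tree_dec_neighbour[OF Cons.prems(1), of c v u] uv by simp
    with uv disj show "v \<in> (\<Union>c\<in>set cs. vs c) - B \<or> u \<in> vs c - B" by auto
  qed
  moreover have "(vs c - B) \<union> ((\<Union>c\<in>set cs. vs c) - B) = (\<Union>c\<in>set (c # cs). vs c) - B" by auto
  ultimately show ?case by metis
qed

lemma path_dec_at_node:
  assumes "tree_dec E V t (Node B (as @ cs))" "\<forall>c\<in>set cs. \<not> contains P (vs c - B)"
  shows "\<exists>bs. path_dec E (vs (Node B cs)) (t + k) bs \<and> bs \<noteq> [] \<and> (\<forall>D\<in>set bs. B \<subseteq> D)"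
proof -
  let ?W = "(\<Union>c\<in>set cs. vs c) - B"
  obtain bs where bs: "path_dec E ?W k bs"
    using path_dec_below[OF assms] by auto
  \<comment> \<open>The extra \<open>{}\<close> yields the bag \<open>B\<close> itself, so the list
    is nonempty and covers \<open>B\<close> even if \<open>bs\<close> is empty.\<close>
  let ?bs = "map ((\<union>) B) ({} # bs)"
  have "card B \<le> t" using assms(1) by (simp add: tree_dec_def)
  then have "card (B \<union> D) \<le> t + k" if "D \<in> set bs" for D
    using bs that by (intro order_trans[OF card_Un_le]) (auto simp: path_dec_def add_mono)
  moreover have "linear_bags ?bs"
    using bs by (intro linear_bags_map_Un) (simp add: path_dec_def)
  moreover have "\<Union>(set ?bs) = vs (Node B cs)"
    using bs by (auto simp: path_dec_def)
  moreover have "covers E (vs (Node B cs)) ?bs"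
    unfolding covers_def
  proof (intro ballI impI)
    fix u v assume uv: "u \<in> vs (Node B cs)" "v \<in> vs (Node B cs)" "(u, v) \<in> E"
    have U: "vs (Node B cs) = B \<union> ?W" "\<Union>(set bs) = ?W" using bs by (auto simp: path_dec_def)
    consider "u \<in> ?W" "v \<in> ?W" | "u \<in> B" | "v \<in> B" using uv U by blast
    then show "\<exists>D\<in>set ?bs. u \<in> D \<and> v \<in> D"
    proof cases
      case 1
      then obtain D where "D \<in> set bs" "u \<in> D" "v \<in> D"
        using bs uv(3) unfolding path_dec_def covers_def by metis
      then show ?thesis by auto
    next
      case 2
      then show ?thesis using uv(2) U by auto
    next
      case 3
      then show ?thesis using uv(1) U by auto
    qed
  qed
  ultimately have "path_dec E (vs (Node B cs)) (t + k) ?bs"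
    using \<open>card B \<le> t\<close> by (auto simp: path_dec_def)
  then show ?thesis by (intro exI[of _ ?bs]) auto
qed

text \<open>The stretch for the node is put before the one for the branch \<open>a\<close>. Shared
  vertices lie in \<open>B\<close>, which is part of every bag of the stretch, and in
  \<open>root a\<close>, which is part of \<open>hd ys\<close>.\<close>

lemma path_dec_through_node:
  assumes "tree_dec E V t (Node B (as @ a # cs))" "\<forall>c\<in>set cs. \<not> contains P (vs c - B)"
    and "path_dec E (vs a) (t + k) ys" "ys \<noteq> []" "root a \<subseteq> hd ys"
  shows "\<exists>bs. path_dec E (vs (Node B (a # cs))) (t + k) bs \<and> bs \<noteq> [] \<and> B \<subseteq> hd bs"
proof -
  have V: "V = vs (Node B (as @ a # cs))" using assms(1) by (simp add: tree_dec_def)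
  obtain xs where xs: "path_dec E (vs (Node B cs)) (t + k) xs" "xs \<noteq> []" "\<forall>D\<in>set xs. B \<subseteq> D"
    using path_dec_at_node[of B "as @ [a]" cs] assms(1,2) by auto
  have disj: "vs a \<inter> B \<subseteq> root a" "\<forall>c\<in>set cs. vs a \<inter> vs c \<subseteq> B"
    using assms(1) by (auto simp: tree_dec_def sorted_wrt_append)
  have "path_dec E (vs (Node B cs) \<union> vs a) (t + k) (xs @ ys)"
  proof (rule path_dec_append[OF sym xs(1) assms(3)])
    have "vs (Node B cs) \<inter> vs a \<subseteq> B \<inter> root a" using disj by auto
    then show "vs (Node B cs) \<inter> vs a \<subseteq> last xs \<inter> hd ys"
      using xs(2,3) assms(5) last_in_set by blast
    fix u v assume uv: "(u, v) \<in> E" "u \<in> vs a" "v \<in> vs (Node B cs)"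
    then have "v \<in> V" using V by auto
    then show "v \<in> vs a \<or> u \<in> vs (Node B cs)"
      using tree_dec_neighbour[OF assms(1), of a u v] uv by auto
  qed
  moreover have "vs (Node B cs) \<union> vs a = vs (Node B (a # cs))" by auto
  moreover have "hd (xs @ ys) \<in> set xs" using xs(2) by simp
  ultimately show ?thesis
    using xs(2,3) by (metis append_is_Nil_conv)
qed

text \<open>\<open>X\<close> and \<open>Y\<close> lie on the root side of the edge to
  \<open>c\<close>. By minimality this side is connected, and it meets \<open>vs c\<close> only in
  \<open>B\<close>, so it avoids \<open>Z\<close>.\<close>

lemma linked_siblings:
  assumes "min_dec (Node B (c # a # b # ts))"
    "X \<subseteq> vs a - B" "Y \<subseteq> vs b - B" "Z \<subseteq> vs c - B" "X \<noteq> {}" "Y \<noteq> {}"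
  shows "linked E (V - Z) X Y"
proof (rule linked_connected_in)
  have dec: "tree_dec E V t (Node B (c # a # b # ts))" using assms(1) by (rule min_dec_tree_dec)
  show "connected_in E (vs (Node B (a # b # ts)))"
    using min_tree_dec_connected_parent[OF sym finite conn assms(1)] assms(2,5) by auto
  have "vs (Node B (a # b # ts)) \<inter> vs c \<subseteq> B" "vs (Node B (a # b # ts)) \<subseteq> V"
    using dec by (auto simp: tree_dec_def)
  then show "vs (Node B (a # b # ts)) \<subseteq> V - Z" using assms(4) by blast
qed (use assms in auto)

text \<open>Three children of the root carrying disjoint sets from \<open>P\<close> would form a tripod, because in
  a minimal decomposition the union of the bags on either side of an edge is connected.\<close>

lemma no_three_branches:
  assumes "min_dec (Node B (a # b # c # ts))"
  shows "\<not> (contains P (vs a - B) \<and> contains P (vs b - B) \<and> contains P (vs c - B))"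
proof
  assume "contains P (vs a - B) \<and> contains P (vs b - B) \<and> contains P (vs c - B)"
  then obtain X Y Z where X: "X \<subseteq> vs a - B" "P X" and Y: "Y \<subseteq> vs b - B" "P Y"
    and Z: "Z \<subseteq> vs c - B" "P Z"
    by (auto simp: contains_def)
  note ne = P_nonempty[OF X(2)] P_nonempty[OF Y(2)] P_nonempty[OF Z(2)]
  have dec: "consistent (Node B (a # b # c # ts))" "V = vs (Node B (a # b # c # ts))"
    using min_dec_tree_dec[OF assms] by (auto simp: tree_dec_def)
  have "X \<inter> Y = {}" "X \<inter> Z = {}" "Y \<inter> Z = {}" using dec X Y Z by auto
  moreover have "X \<subseteq> V" "Y \<subseteq> V" "Z \<subseteq> V" using dec X Y Z by auto
  moreover have "linked E (V - Z) X Y"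
    by (rule linked_siblings[OF min_tree_dec_mset[OF assms, of "c # a # b # ts"]])
      (use X Y Z ne in auto)
  moreover have "linked E (V - Y) X Z"
    by (rule linked_siblings[OF min_tree_dec_mset[OF assms, of "b # a # c # ts"]])
      (use X Y Z ne in auto)
  moreover have "linked E (V - X) Y Z"
    by (rule linked_siblings[OF assms]) (use X Y Z ne in auto)
  ultimately have "tripod E P V"
    unfolding tripod_def using X Y Z by blast
  with no_tripod show False ..
qed

text \<open>\<open>s\<close> is the rich branch behind and \<open>Node B ts\<close> the part still
  ahead, whose size is the induction measure. The path ends where no rich branch lies ahead.\<close>

lemma path_dec_away_from_branch:
  assumes "min_dec (Node B (s # ts))" "contains P (vs s - B)"
  shows "\<exists>bs. path_dec E (vs (Node B ts)) (t + k) bs \<and> bs \<noteq> [] \<and> B \<subseteq> hd bs"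
  using assms
proof (induction "Node B ts" arbitrary: B s ts rule: measure_induct_rule[of size])
  case less
  show ?case
  proof (cases "\<forall>a\<in>set ts. \<not> contains P (vs a - B)")
    case True
    then show ?thesis
      using path_dec_at_node[of B "[s]" ts] min_dec_tree_dec[OF less.prems(1)]
      by (metis append_Cons append_Nil hd_in_set)
  next
    case False
    then obtain a where a: "a \<in> set ts" "contains P (vs a - B)" by blast
    then obtain us ws where ts: "ts = us @ a # ws" by (meson split_list)
    let ?ts = "us @ ws"
    have R: "min_dec (Node B (a # s # ?ts))"
      using less.prems(1) by (rule min_tree_dec_mset) (simp add: ts)
    \<comment> \<open>Since \<open>s\<close> and \<open>a\<close> are rich, a third rich branch is
      impossible.\<close>
    have others: "\<forall>b\<in>set ?ts. \<not> contains P (vs b - B)"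
    proof
      fix b assume b: "b \<in> set ?ts"
      then obtain us' ws' where ts': "?ts = us' @ b # ws'" by (meson split_list)
      have "min_dec (Node B (a # s # b # us' @ ws'))"
        using R by (rule min_tree_dec_mset) (use ts' in simp)
      then show "\<not> contains P (vs b - B)"
        using no_three_branches a(2) less.prems(2) by blast
    qed
    obtain C cs where C: "a = Node C cs" by (cases a)
    have "vs s \<inter> vs a \<subseteq> B"
      using min_dec_tree_dec[OF R] by (auto simp: tree_dec_def)
    \<comment> \<open>Seen from the next node, the branch leading back is rich because it contains
      what made \<open>s\<close> rich.\<close>
    then have "vs s - B \<subseteq> vs (Node B (s # ?ts)) - C" by (auto simp: C)
    then have "contains P (vs (Node B (s # ?ts)) - C)"
      by (rule contains_mono[OF less.prems(2)])
    moreover have "min_dec (Node C (Node B (s # ?ts) # cs))"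
      using min_tree_dec_reroot R by (simp add: C)
    moreover have "size (Node C cs) < size (Node B ts)"
      using a(1) size_list_estimation'[of a ts "size a" size] by (simp add: C less_Suc_eq_le)
    ultimately obtain ys where "path_dec E (vs a) (t + k) ys" "ys \<noteq> []" "root a \<subseteq> hd ys"
      using less.hyps[of C cs "Node B (s # ?ts)"] C by auto
    moreover have "tree_dec E V t (Node B ([s] @ a # ?ts))"
      using min_dec_tree_dec[OF R] by (rule tree_dec_mset) simp
    ultimately have "\<exists>bs. path_dec E (vs (Node B (a # ?ts))) (t + k) bs \<and> bs \<noteq> [] \<and> B \<subseteq> hd bs"
      using path_dec_through_node others by blast
    moreover have "vs (Node B (a # ?ts)) = vs (Node B ts)" by (auto simp: ts)
    ultimately show ?thesis by simp
  qed
qed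

text \<open>The path of bags starts next to a smallest branch containing a member of \<open>P\<close>.\<close>

lemma path_dec_from_min_dec:
  assumes "min_dec R"
  shows "\<exists>bs. path_dec E V (t + k) bs"
proof (cases "\<exists>B s ts. min_dec (Node B (s # ts)) \<and> contains P (vs s - B)")
  \<comment> \<open>No branch is rich, so a path consisting of the root alone suffices.\<close>
  case False
  obtain B ts where R: "R = Node B ts" by (cases R)
  have "\<not> contains P (vs s - B)" if "s \<in> set ts" for s
  proof -
    obtain us ws where "ts = us @ s # ws" using split_list[OF \<open>s \<in> set ts\<close>] by auto
    then have "min_dec (Node B (s # us @ ws))"
      using assms by (simp add: R min_tree_dec_mset[of _ _ _ B ts])
    then show ?thesis using False by blast
  qed
  moreover have "tree_dec E V t (Node B ([] @ ts))" "vs (Node B ts) = V"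
    using min_dec_tree_dec[OF assms] by (auto simp: R tree_dec_def)
  ultimately show ?thesis using path_dec_at_node[of B "[]" ts] by metis
next
  case True
  \<comment> \<open>The smallest rich branch is taken over all minimal decompositions of
    \<open>V\<close>, which include the rerooted and permuted forms of \<open>R\<close>.\<close>
  define Q where "Q = (\<lambda>s. \<exists>B ts. min_dec (Node B (s # ts)) \<and> contains P (vs s - B))"
  from True obtain s where s: "Q s" and smallest: "\<And>s'. Q s' \<Longrightarrow> size s \<le> size s'"
    using ex_has_least_nat[of Q _ size] unfolding Q_def by meson
  then obtain B ts where R: "min_dec (Node B (s # ts))" and P: "contains P (vs s - B)"
    by (auto simp: Q_def)
  obtain C cs where C: "s = Node C cs" by (cases s)
  have R': "min_dec (Node C (Node B ts # cs))"
    using R C min_tree_dec_reroot by simp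
  \<comment> \<open>A rich child of \<open>C\<close> inside \<open>s\<close> would be a smaller
    candidate, so only the branch back to \<open>B\<close> can be rich and the path may start at
    \<open>C\<close>.\<close>
  have "\<not> contains P (vs c - C)" if c: "c \<in> set cs" for c
  proof
    assume "contains P (vs c - C)"
    moreover obtain us ws where "cs = us @ c # ws" using c by (meson split_list)
    then have "min_dec (Node C (c # Node B ts # us @ ws))"
      using R' by (simp add: min_tree_dec_mset[of _ _ _ C "Node B ts # cs"])
    ultimately have "Q c" unfolding Q_def by blast
    then have "size s \<le> size c" by (rule smallest)
    then show False
      using c size_list_estimation'[of c cs "size c" size] by (simp add: C)
  qed
  moreover obtain ys where "path_dec E (vs (Node B ts)) (t + k) ys" "ys \<noteq> []" "B \<subseteq> hd ys"
    using path_dec_away_from_branch[OF R P] by blast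
  moreover have "tree_dec E V t (Node C ([] @ Node B ts # cs))"
    using min_dec_tree_dec[OF R'] by simp
  ultimately have "\<exists>bs. path_dec E (vs (Node C (Node B ts # cs))) (t + k) bs"
    using path_dec_through_node[of C "[]" "Node B ts" cs ys] by auto
  moreover have "vs (Node C (Node B ts # cs)) = V"
    using min_dec_tree_dec[OF R'] by (simp add: tree_dec_def)
  ultimately show ?thesis by simp
qed

end

text \<open>Counted in bag sizes: two in the base case, and \<open>t\<close> more for each
  step.\<close>

lemma path_dec_or_ternary:
  assumes "sym E" "finite W" "connected_in E W" "tree_dec E W t R" "\<not> ternary E (Suc h) W"
  shows "\<exists>bs. path_dec E W (t * h + 2) bs"
  using assms(2-5)
proof (induction h arbitrary: W R)
  case 0
  then show ?case using path_dec_without_tripod[OF assms(1) 0(1,2)] by (simp del: ternary.simps add: numeral_2_eq_2)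
next
  case (Suc h)
  interpret tripod_free E W t "t * h + 2" "ternary E (Suc h)"
  proof
    show "C \<noteq> {}" if "ternary E (Suc h) C" for C
      using ternary_connected_in[OF that] by (auto simp: connected_in_def)
    \<comment> \<open>The induction hypothesis is applied to the decomposition restricted to
      \<open>C\<close>.\<close>
    show "\<exists>bs. path_dec E C (t * h + 2) bs"
      if "C \<subseteq> W" "connected_in E C" "\<not> ternary E (Suc h) C" for C
      using Suc.IH[OF finite_subset[OF that(1) Suc.prems(1)] that(2)
        tree_dec_restrict[OF Suc.prems(3,1) that(1)] that(3)] .
    show "\<not> tripod E (ternary E (Suc h)) W"
      using Suc.prems(2,4) by simp
  qed (use assms(1) Suc.prems in auto)
  obtain R' where "min_tree_dec E W t R'"
    using ex_has_least_nat[of "tree_dec E W t" R weight] Suc.prems(3)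
    unfolding min_tree_dec_def by metis
  then show ?case using path_dec_from_min_dec by (simp add: add.assoc)
qed

section \<open>From digraphs to relations\<close>

text \<open>The symmetric closure in \<open>connected\<close> changes nothing, since the arcs are
  already symmetric.\<close>

lemma connected_iff_connected_in:
  assumes "graph G"
  shows "connected G \<longleftrightarrow> connected_in (arcs_ends G) (verts G)"
proof -
  interpret graph G by fact
  have "Restr (arcs_ends G) (verts G) = arcs_ends G" using adj_in_verts by auto
  then show ?thesis
    using reachable_mk_symmetric_eq[OF sym_arcs] reachable_conv'
    by (simp add: connected_def strongly_connected_def connected_in_def)
qed

lemma arcs_ends_induce: "arcs_ends (G \<restriction> W) = Restr (arcs_ends G) W"
  by (auto simp: arcs_ends_conv)

lemma connected_in_Restr: "connected_in (Restr E W) W \<longleftrightarrow> connected_in E W"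
  by (simp add: connected_in_def Int_assoc)

lemma graph_induce:
  assumes "graph G" "W \<subseteq> verts G"
  shows "graph (G \<restriction> W)"
proof -
  interpret graph G by fact
  have "finite W" using assms(2) finite_verts by (rule finite_subset)
  moreover have "symmetric (G \<restriction> W)"
    using sym_arcs by (auto simp: symmetric_def arcs_ends_induce sym_def)
  ultimately show ?thesis
    by unfold_locales (auto simp: arc_to_ends_def no_loops intro: no_multi_arcs)
qed

lemma connected_induce:
  assumes "graph G" "W \<subseteq> verts G"
  shows "connected (G \<restriction> W) \<longleftrightarrow> connected_in (arcs_ends G) W"
  using connected_iff_connected_in[OF graph_induce[OF assms]]
  by (simp add: arcs_ends_induce connected_in_Restr)

section \<open>From walks inside a set to paths avoiding its complement\<close>

lemma rtrancl_imp_vpath: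
  assumes "(a, b) \<in> (Restr (arcs_ends G) U)\<^sup>*" "a \<in> U" "U \<subseteq> verts G"
  shows "\<exists>p. vpath p G \<and> hd p = a \<and> last p = b \<and> set p \<subseteq> U"
proof -
  have "b \<in> U" using assms(1,2) by (rule rtrancl_closed) auto
  with assms(1) have "\<exists>p. vwalk p G \<and> hd p = a \<and> last p = b \<and> set p \<subseteq> U"
  proof (induction rule: converse_rtrancl_induct)
    case base
    then show ?case using assms(3) by (intro exI[of _ "[b]"]) auto
  next
    case (step y z)
    then obtain p where p: "vwalk p G" "hd p = z" "last p = b" "set p \<subseteq> U" by auto
    then have "vwalk (y # p) G" using step.hyps(1) assms(3) by (intro vwalk_consI) auto
    then show ?case using p step.hyps(1) by (intro exI[of _ "y # p"]) auto
  qed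
  then obtain p where p: "vwalk p G" "hd p = a" "last p = b" "set p \<subseteq> U" by auto
  then show ?thesis
    using vwalk_to_vpath_vpath[OF p(1)] vwalk_to_vpath_hd[of p] vwalk_to_vpath_last[of p]
      vwalk_to_vpath_subset[of _ p] by (intro exI[of _ "vwalk_to_vpath p"]) auto
qed

lemma linked_imp_path_avoiding:
  assumes "linked (arcs_ends G) (W - Z) X Y" "W \<subseteq> verts G"
  shows "path_avoiding (G \<restriction> W) X Y Z"
proof -
  let ?H = "G \<restriction> W"
  have "Restr (arcs_ends G) (W - Z) = Restr (arcs_ends ?H) (W - Z)"
    by (auto simp: arcs_ends_induce)
  then obtain x y where xy: "x \<in> X" "x \<in> W - Z" "y \<in> Y" "(x, y) \<in> (Restr (arcs_ends ?H) (W - Z))\<^sup>*"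
    using assms(1) unfolding linked_def by auto
  then show ?thesis
    using rtrancl_imp_vpath[OF xy(4,2)] unfolding path_avoiding_def by fastforce
qed

lemma ternary_imp_T_class:
  assumes "graph G" "ternary (arcs_ends G) h W" "W \<subseteq> verts G"
  shows "G \<restriction> W \<in> T_class h"
  using assms(2,3)
proof (induction h arbitrary: W)
  case 0
  then show ?case using assms(1) by (simp add: graph_induce connected_induce)
next
  case (Suc h)
  then obtain V1 V2 V3 where V: "V1 \<subseteq> W" "V2 \<subseteq> W" "V3 \<subseteq> W"
    "V1 \<inter> V2 = {}" "V1 \<inter> V3 = {}" "V2 \<inter> V3 = {}"
    and t: "ternary (arcs_ends G) h V1" "ternary (arcs_ends G) h V2" "ternary (arcs_ends G) h V3"
    and l: "linked (arcs_ends G) (W - V3) V1 V2" "linked (arcs_ends G) (W - V2) V1 V3"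
      "linked (arcs_ends G) (W - V1) V2 V3"
    by (auto simp: tripod_def)
  \<comment> \<open>Inducing twice amounts to inducing once, so the induction hypothesis for
    subgraphs of \<open>G\<close> applies.\<close>
  have "(G \<restriction> W) \<restriction> U = G \<restriction> U" if "U \<subseteq> W" for U
    using that by (auto simp: induce_subgraph_def)
  then have "(G \<restriction> W) \<restriction> V1 \<in> T_class h" "(G \<restriction> W) \<restriction> V2 \<in> T_class h" "(G \<restriction> W) \<restriction> V3 \<in> T_class h"
    using Suc.IH t V(1-3) Suc.prems(2) by simp_all
  moreover have "graph (G \<restriction> W)" "connected (G \<restriction> W)"
    using assms(1) Suc.prems by (simp_all add: graph_induce connected_induce)
  moreover note l[THEN linked_imp_path_avoiding[OF _ Suc.prems(2)]] V
  ultimately show ?case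
    unfolding T_class.simps mem_Collect_eq
    by (intro conjI exI[of _ V1] exI[of _ V2] exI[of _ V3]) simp_all
qed

section \<open>From tree decompositions to trees of bags\<close>

text \<open>The root moves towards \<open>D\<close> one edge at a time; before each move the child
  containing \<open>D\<close> is brought to the front.\<close>

lemma reroot_at_descendant:
  assumes "consistent (Node B (s # ts))" "D \<in> set (bags s)"
  shows "\<exists>R. consistent R \<and> set (bags R) = set (bags (Node B (s # ts))) \<and> root R = D"
  using assms
proof (induction s arbitrary: B ts)
  case (Node C cs)
  have R: "consistent (Node C (Node B ts # cs))"
    using Node.prems(1) by (rule consistent_reroot)
  have b: "set (bags (Node C (Node B ts # cs))) = set (bags (Node B (Node C cs # ts)))" by auto
  show ?case
  proof (cases "D = C")
    case True
    with R b show ?thesis by (intro exI[of _ "Node C (Node B ts # cs)"]) simp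
  next
    case False
    then obtain c where c: "c \<in> set cs" "D \<in> set (bags c)" using Node.prems(2) by auto
    then obtain us ws where cs: "cs = us @ c # ws" by (meson split_list)
    have "consistent (Node C (c # Node B ts # us @ ws))"
      using R by (rule consistent_mset) (simp add: cs)
    from Node.IH[OF c(1) this c(2)] obtain R' where
      "consistent R'" "set (bags R') = set (bags (Node C (c # Node B ts # us @ ws)))" "root R' = D"
      by blast
    moreover have "set (bags (Node C (c # Node B ts # us @ ws))) = set (bags (Node B (Node C cs # ts)))"
      by (auto simp: cs)
    ultimately show ?thesis by auto
  qed
qed

lemma reroot:
  assumes "consistent R" "D \<in> set (bags R)"
  shows "\<exists>R'. consistent R' \<and> set (bags R') = set (bags R) \<and> root R' = D"
proof -
  obtain B ts where R: "R = Node B ts" by (cases R)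
  show ?thesis
  proof (cases "D = B")
    case True
    then show ?thesis using assms(1) R by (intro exI[of _ R]) simp
  next
    case False
    then obtain s where s: "s \<in> set ts" "D \<in> set (bags s)" using assms(2) R by auto
    then obtain us ws where ts: "ts = us @ s # ws" by (meson split_list)
    have "consistent (Node B (s # us @ ws))"
      using assms(1) unfolding R by (rule consistent_mset) (simp add: ts)
    from reroot_at_descendant[OF this s(2)] show ?thesis by (auto simp: R ts Un_left_commute)
  qed
qed

text \<open>A largest connected node set that has a bag tree is everything, because an edge leaving
  it allows one more leaf. Acyclicity of the tree enters through \<open>leaf\<close>.\<close>

lemma bag_tree_of_tree:
  assumes "finite N" "sym F" "connected_in F N"
    and leaf: "\<And>M x y. M \<subseteq> N \<Longrightarrow> connected_in F M \<Longrightarrow> x \<in> M \<Longrightarrow> y \<in> N - M \<Longrightarrow> (x, y) \<in> F \<Longrightarrow>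
      B y \<inter> \<Union>(B ` M) \<subseteq> B x"
  shows "\<exists>R. consistent R \<and> set (bags R) = B ` N"
proof -
  define Q where "Q = (\<lambda>M. M \<subseteq> N \<and> connected_in F M \<and> (\<exists>R. consistent R \<and> set (bags R) = B ` M))"
  obtain n where "n \<in> N" using assms(3) by (auto simp: connected_in_def)
  then have "Q {n}"
    unfolding Q_def by (auto simp: connected_in_singleton intro!: exI[of _ "Node (B n) []"])
  moreover have "card M \<le> card N" if "Q M" for M
    using that assms(1) by (simp add: Q_def card_mono)
  ultimately obtain M where M: "Q M" and largest: "\<And>M'. Q M' \<Longrightarrow> card M' \<le> card M"
    using ex_has_greatest_nat[of Q "{n}" card "Suc (card N)"] by (metis less_Suc_eq_le)
  obtain R where MN: "M \<subseteq> N" "connected_in F M" and R: "consistent R" "set (bags R) = B ` M"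
    using M by (auto simp: Q_def)
  have "N \<subseteq> M"
  proof (rule ccontr)
    assume "\<not> N \<subseteq> M"
    moreover obtain m where "m \<in> M" using MN(2) by (auto simp: connected_in_def)
    ultimately obtain x y where xy: "x \<in> M" "y \<in> N - M" "(x, y) \<in> F"
      using connected_in_closed[OF assms(3), of m M] MN(1) by blast
    \<comment> \<open>Several nodes may carry the bag \<open>B x\<close>; any of them can receive
      the new leaf, as only its bag matters.\<close>
    obtain R' where R': "consistent R'" "set (bags R') = B ` M" "root R' = B x"
      using reroot[OF R(1), of "B x"] R(2) xy(1) by auto
    then obtain ts where ts: "R' = Node (B x) ts" by (cases R') auto
    let ?R = "Node (B x) (Node (B y) [] # ts)"
    have "B y \<inter> vs R' \<subseteq> B x" using leaf[OF MN xy] R'(2) by (simp add: vs_def)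
    then have "consistent ?R" using R'(1) by (auto simp: ts)
    moreover have "set (bags ?R) = B ` insert y M" using R'(2) by (auto simp: ts)
    moreover have "connected_in F (insert y M)"
      using connected_in_insert[OF assms(2) MN(2) xy(1,3)] .
    ultimately have "Q (insert y M)" using MN xy unfolding Q_def by blast
    then have "card (insert y M) \<le> card M" by (rule largest)
    then show False using xy MN(1) assms(1) finite_subset[of M N] by auto
  qed
  then show ?thesis using MN R by auto
qed

text \<open>Consider the last departure of the walk from \<open>y\<close>.\<close>

lemma rtrancl_leave:
  assumes "(y, z) \<in> (Restr F U)\<^sup>*" "y \<noteq> z"
  shows "\<exists>y'. (y, y') \<in> F \<and> y' \<in> U - {y} \<and> (y', z) \<in> (Restr F (U - {y}))\<^sup>*"
  using assms
proof (induction rule: rtrancl_induct)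
  case (step z w)
  show ?case
  proof (cases "z = y")
    case True
    then show ?thesis using step by auto
  next
    case False
    then obtain y' where y': "(y, y') \<in> F" "y' \<in> U - {y}" "(y', z) \<in> (Restr F (U - {y}))\<^sup>*"
      using step.IH by auto
    moreover have "(z, w) \<in> Restr F (U - {y})" using step False by auto
    ultimately show ?thesis by (meson rtrancl_into_rtrancl)
  qed
qed simp

text \<open>Such a walk contains a path from \<open>y'\<close> to \<open>x\<close> that
  \<open>y\<close> closes to a cycle; it has at least three vertices because
  \<open>y' \<noteq> x\<close>.\<close>

lemma undirected_tree_no_detour:
  assumes "undirected_tree T" "y \<in> verts T" "y \<rightarrow>\<^bsub>T\<^esub> y'" "x \<rightarrow>\<^bsub>T\<^esub> y" "y' \<in> verts T - {y}" "y' \<noteq> x"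
  shows "(y', x) \<notin> (Restr (arcs_ends T) (verts T - {y}))\<^sup>*"
proof
  assume "(y', x) \<in> (Restr (arcs_ends T) (verts T - {y}))\<^sup>*"
  from rtrancl_imp_vpath[OF this assms(5)] obtain q where
    q: "vpath q T" "hd q = y'" "last q = x" "set q \<subseteq> verts T - {y}" by blast
  obtain a b r where "q = a # b # r"
    using q(1-3) assms(6) by (cases q rule: vwalk_arcs.cases) (auto simp: vpath_def vwalk_def)
  moreover have "vpath (y # q) T"
    using q assms(2,3) vwalk_consI[of q T y] by (auto simp: vpath_def)
  ultimately have "vpath (y # q) T \<and> length (y # q) \<ge> 3 \<and> last (y # q) \<rightarrow>\<^bsub>T\<^esub> hd (y # q)"
    using q(3) assms(4) by auto
  then show False using assms(1) unfolding undirected_tree_def by blast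
qed

text \<open>Otherwise some vertex is in \<open>B y\<close> and in \<open>B z\<close> with
  \<open>z\<close> in \<open>M\<close>, but not in \<open>B x\<close>. A walk from \<open>y\<close>
  to \<open>z\<close> through nodes whose bags contain it, continued inside \<open>M\<close> to
  \<open>x\<close>, gives a detour around \<open>y\<close>.\<close>

lemma tree_decomposition_leaf:
  assumes "tree_decomposition G T B" "M \<subseteq> verts T" "connected_in (arcs_ends T) M" "x \<in> M"
    "y \<in> verts T - M" "x \<rightarrow>\<^bsub>T\<^esub> y"
  shows "B y \<inter> \<Union>(B ` M) \<subseteq> B x"
proof (rule ccontr)
  assume "\<not> B y \<inter> \<Union>(B ` M) \<subseteq> B x"
  then obtain v z where v: "v \<in> B y" "z \<in> M" "v \<in> B z" "v \<notin> B x" by auto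
  have tree: "undirected_tree T" "graph T"
    using assms(1) by (auto simp: tree_decomposition_def undirected_tree_def)
  let ?N = "{n \<in> verts T. v \<in> B n}"
  have "v \<in> verts G" using assms(1,5) v(1) by (auto simp: tree_decomposition_def)
  then have "connected_in (arcs_ends T) ?N"
    using assms(1) connected_induce[OF tree(2), of ?N] by (auto simp: tree_decomposition_def)
  then have "(y, z) \<in> (Restr (arcs_ends T) ?N)\<^sup>*" "y \<noteq> z"
    using v assms(2,5) by (auto simp: connected_in_def)
  from rtrancl_leave[OF this] obtain y' where
    y': "y \<rightarrow>\<^bsub>T\<^esub> y'" "y' \<in> ?N - {y}" "(y', z) \<in> (Restr (arcs_ends T) (?N - {y}))\<^sup>*" by blast
  have "(y', z) \<in> (Restr (arcs_ends T) (verts T - {y}))\<^sup>*"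
    using y'(3) Restr_mono[of "?N - {y}" "verts T - {y}"] by blast
  moreover have "(z, x) \<in> (Restr (arcs_ends T) (verts T - {y}))\<^sup>*"
    using assms(2-5) v(2) Restr_mono[of M "verts T - {y}"] unfolding connected_in_def by blast
  ultimately have "(y', x) \<in> (Restr (arcs_ends T) (verts T - {y}))\<^sup>*" by (rule rtrancl_trans)
  moreover have "y' \<noteq> x" using y'(2) v(4) by auto
  ultimately show False
    using undirected_tree_no_detour[OF tree(1) _ y'(1) assms(6)] assms(5) y'(2) by blast
qed

lemma tree_dec_of_tree_decomposition:
  assumes "graph G" "tree_decomposition G T B" "\<And>x. x \<in> verts T \<Longrightarrow> card (B x) \<le> t"
  shows "\<exists>R. tree_dec (arcs_ends G) (verts G) t R"
proof -
  have T: "graph T" "connected T"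
    using assms(2) by (auto simp: tree_decomposition_def undirected_tree_def)
  interpret T: graph T by fact
  have "sym (arcs_ends T)" using T.sym_arcs by (simp add: symmetric_def)
  moreover have "connected_in (arcs_ends T) (verts T)"
    using T by (simp add: connected_iff_connected_in)
  ultimately have "\<exists>R. consistent R \<and> set (bags R) = B ` verts T"
    by (rule bag_tree_of_tree[OF T.finite_verts]) (rule tree_decomposition_leaf[OF assms(2)])
  then obtain R where R: "consistent R" "set (bags R) = B ` verts T" by blast
  have "vs R = verts G"
  proof
    show "vs R \<subseteq> verts G" using assms(2) R(2) by (auto simp: vs_def tree_decomposition_def)
    show "verts G \<subseteq> vs R"
    proof
      fix v assume "v \<in> verts G"
      then have "connected (T \<restriction> {x \<in> verts T. v \<in> B x})"
        using assms(2) by (simp add: tree_decomposition_def)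
      then show "v \<in> vs R"
        using R(2) by (auto simp: connected_def strongly_connected_def vs_def)
    qed
  qed
  moreover have "covers (arcs_ends G) (verts G) (bags R)"
    using assms(2) R(2) by (auto simp: covers_def tree_decomposition_def)
  ultimately have "tree_dec (arcs_ends G) (verts G) t R"
    using R assms(3) by (auto simp: tree_dec_def)
  then show ?thesis ..
qed

section \<open>From lists of bags to path decompositions\<close>

definition path_nat :: "nat \<Rightarrow> nat pair_pre_digraph" where
  "path_nat n = \<lparr>pverts = {..<n}, parcs = {(i, j). i < n \<and> j < n \<and> (j = Suc i \<or> i = Suc j)}\<rparr>"

lemma path_nat_simps [simp]:
  "pverts (path_nat n) = {..<n}"
  "parcs (path_nat n) = {(i, j). i < n \<and> j < n \<and> (j = Suc i \<or> i = Suc j)}"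
  by (simp_all add: path_nat_def)

lemma graph_path_nat: "graph (with_proj (path_nat n))"
proof -
  have "finite {(i, j). i < n \<and> j < n \<and> (j = Suc i \<or> i = Suc j)}"
    by (rule finite_subset[of _ "{..<n} \<times> {..<n}"]) auto
  then show ?thesis
    by unfold_locales (auto simp: arc_to_ends_def symmetric_def sym_def)
qed

lemma vwalk_arcs_upt: "set (vwalk_arcs [0..<n]) = {(i, Suc i) | i. Suc i < n}"
proof (induction n)
  case (Suc n)
  show ?case
  proof (cases "n = 0")
    case False
    then have "set (vwalk_arcs [0..<Suc n]) = insert (last [0..<n], n) (set (vwalk_arcs [0..<n]))"
      by (simp add: set_vwalk_arcs_snoc)
    also have "last [0..<n] = n - 1" using False by simp
    finally show ?thesis using False Suc by (auto simp: less_Suc_eq)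
  qed simp
qed simp

lemma path_graph_path_nat: "n > 0 \<Longrightarrow> path_graph (with_proj (path_nat n))"
  unfolding path_graph_def
  by (intro conjI graph_path_nat exI[of _ "[0..<n]"]) (auto simp: vwalk_arcs_upt)

lemma connected_in_path_nat:
  assumes "I \<subseteq> {..<n}" "I \<noteq> {}" "\<And>i j l. i \<in> I \<Longrightarrow> l \<in> I \<Longrightarrow> i \<le> j \<Longrightarrow> j \<le> l \<Longrightarrow> j \<in> I"
  shows "connected_in (parcs (path_nat n)) I"
proof -
  have "sym (parcs (path_nat n))" by (auto simp: sym_def)
  moreover have "(i, j) \<in> (Restr (parcs (path_nat n)) I)\<^sup>*" if "i \<le> j" "i \<in> I" "j \<in> I" for i j
    using that
  proof (induction j rule: dec_induct)
    case (step m)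
    then have "m \<in> I" using assms(3)[of i "Suc m" m] by simp
    then have "(m, Suc m) \<in> Restr (parcs (path_nat n)) I" using step assms(1) by auto
    moreover have "(i, m) \<in> (Restr (parcs (path_nat n)) I)\<^sup>*" using step \<open>m \<in> I\<close> by simp
    ultimately show ?case by (meson rtrancl_into_rtrancl)
  qed simp
  ultimately have "(i, j) \<in> (Restr (parcs (path_nat n)) I)\<^sup>*" if "i \<in> I" "j \<in> I" for i j
    using that by (metis nle_le sym_Restr_rtrancl)
  then show ?thesis using assms(2) by (simp add: connected_in_def)
qed

text \<open>Steps change the position by one, so a walk cannot jump over \<open>a\<close>.\<close>

lemma vwalk_path_nat_side:
  assumes "vwalk p (with_proj (path_nat n))" "a \<notin> set p"
  shows "(hd p < a \<longrightarrow> (\<forall>x\<in>set p. x < a)) \<and> (a < hd p \<longrightarrow> (\<forall>x\<in>set p. a < x))"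
  using assms by (induction rule: vwalk_induct) auto

lemma undirected_tree_path_nat:
  assumes "n > 0"
  shows "undirected_tree (with_proj (path_nat n))"
  unfolding undirected_tree_def
proof (intro conjI graph_path_nat notI)
  show "connected (with_proj (path_nat n))"
    using connected_in_path_nat[of "{..<n}" n] assms
    by (simp add: connected_iff_connected_in[OF graph_path_nat] lessThan_empty_iff)
  assume "\<exists>p. vpath p (with_proj (path_nat n)) \<and> 3 \<le> length p \<and> last p \<rightarrow>\<^bsub>with_proj (path_nat n)\<^esub> hd p"
  then obtain p where p: "vpath p (with_proj (path_nat n))" "3 \<le> length p"
    "last p \<rightarrow>\<^bsub>with_proj (path_nat n)\<^esub> hd p" by blast
  then obtain a b c q where q: "p = a # b # c # q"
    by (metis Suc_le_length_iff numeral_3_eq_3)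
  let ?q = "b # c # q"
  have w: "vwalk ?q (with_proj (path_nat n))" "a \<notin> set ?q" "(a, b) \<in> parcs (path_nat n)"
    and dist: "distinct ?q"
    using p(1) by (auto simp: q vpath_def vwalk_def)
  have "last ?q \<in> set (c # q)" by simp
  \<comment> \<open>Both \<open>b\<close> and \<open>last ?q\<close> are neighbours of
    \<open>a\<close>; being distinct, they lie on opposite sides of \<open>a\<close>, yet
    \<open>?q\<close> joins them avoiding \<open>a\<close>.\<close>
  then have d: "b \<noteq> last ?q" using dist by (metis distinct.simps(2))
  have "(last ?q, a) \<in> parcs (path_nat n)" using p(3) by (simp add: q)
  then have "b < a \<and> a < last ?q \<or> a < b \<and> last ?q < a"
    using w(3) d by auto
  moreover have "last ?q \<in> set ?q" by simp
  ultimately show False using vwalk_path_nat_side[OF w(1,2)] by fastforce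
qed

text \<open>The local condition carries a vertex that occurs again later from each bag to the
  next.\<close>

lemma linear_bags_convex:
  assumes "linear_bags bs" "v \<in> bs ! i" "v \<in> bs ! l" "i \<le> j" "j \<le> l" "l < length bs"
  shows "v \<in> bs ! j"
  using assms
proof (induction bs arbitrary: i j l)
  case (Cons b bs)
  show ?case
  proof (cases j)
    case 0
    then show ?thesis using Cons.prems by simp
  next
    case (Suc j')
    then obtain l' where l': "l = Suc l'" "j' \<le> l'" "l' < length bs" "v \<in> bs ! l'"
      using Cons.prems by (cases l) auto
    show ?thesis
    proof (cases i)
      case 0
      then have "v \<in> b \<inter> \<Union>(set bs)" using Cons.prems(2) l' nth_mem[of l' bs] by auto
      then have "v \<in> hd bs" using Cons.prems(1) by auto
      then have "v \<in> bs ! 0" using l' by (cases bs) auto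
      then show ?thesis using Cons.IH[of 0 l' j'] Cons.prems(1) l' Suc by simp
    next
      case (Suc i')
      then show ?thesis using Cons.IH[of i' l' j'] Cons.prems l' \<open>j = Suc j'\<close> by simp
    qed
  qed
qed simp

lemma path_decomposition_of_path_dec:
  assumes "path_dec (arcs_ends G) (verts G) k bs" "graph G" "verts G \<noteq> {}"
  shows "path_decomposition G (with_proj (path_nat (length bs))) ((!) bs)"
    and "decomposition_width (with_proj (path_nat (length bs))) ((!) bs) \<le> int k - 1"
proof -
  let ?T = "with_proj (path_nat (length bs))"
  interpret graph G by fact
  have bs: "linear_bags bs" "\<Union>(set bs) = verts G" "covers (arcs_ends G) (verts G) bs"
    "\<forall>D\<in>set bs. card D \<le> k" using assms(1) by (auto simp: path_dec_def)
  \<comment> \<open>The path needs at least one node; a nonempty graph rules out the empty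
    list.\<close>
  then have n: "length bs > 0" using assms(3) by auto
  have "connected (?T \<restriction> {x \<in> verts ?T. v \<in> bs ! x})" if "v \<in> verts G" for v
  proof -
    let ?I = "{x. x < length bs \<and> v \<in> bs ! x}"
    obtain D where "D \<in> set bs" "v \<in> D" using \<open>v \<in> verts G\<close> bs(2) by auto
    then have "?I \<noteq> {}" by (auto simp: in_set_conv_nth)
    moreover have "j \<in> ?I" if "i \<in> ?I" "l \<in> ?I" "i \<le> j" "j \<le> l" for i j l
      using that linear_bags_convex[OF bs(1), of v i l j] by simp
    ultimately have "connected_in (parcs (path_nat (length bs))) ?I"
      by (intro connected_in_path_nat) blast+
    then show ?thesis
      using connected_induce[OF graph_path_nat, of ?I "length bs"]
      by (simp only: with_proj_simps path_nat_simps lessThan_iff) blast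
  qed
  moreover have "\<exists>x\<in>verts ?T. u \<in> bs ! x \<and> v \<in> bs ! x" if "u \<rightarrow>\<^bsub>G\<^esub> v" for u v
  proof -
    have "\<exists>D\<in>set bs. u \<in> D \<and> v \<in> D"
      using that bs(3) adj_in_verts[OF that] unfolding covers_def by blast
    then obtain D where D: "D \<in> set bs" "u \<in> D" "v \<in> D" by blast
    then obtain x where "x < length bs" "bs ! x = D" by (auto simp: in_set_conv_nth)
    with D show ?thesis by (intro bexI[of _ x]) auto
  qed
  moreover have "bs ! x \<subseteq> verts G" if "x \<in> verts ?T" for x
    using that bs(2) nth_mem[of x bs] by auto
  ultimately show "path_decomposition G ?T ((!) bs)"
    using undirected_tree_path_nat[OF n] path_graph_path_nat[OF n]
    by (simp add: path_decomposition_def tree_decomposition_def)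
  have "Max ((\<lambda>x. card (bs ! x)) ` {..<length bs}) \<le> k"
    using bs(4) n by (intro Max.boundedI) (auto simp: lessThan_empty_iff)
  then show "decomposition_width ?T ((!) bs) \<le> int k - 1"
    by (simp add: decomposition_width_def)
qed

section \<open>Width parameters\<close>

text \<open>The integers are not well-ordered, so a lower bound is used to move the minimum to the
  naturals.\<close>

lemma Least_int_bounded:
  fixes P :: "int \<Rightarrow> bool"
  assumes "P w" "\<And>w. P w \<Longrightarrow> b \<le> w"
  shows "P (Least P)" and "Least P \<le> w"
proof -
  define n where "n = (LEAST n. P (b + int n))"
  have ex: "P (b + int (nat (v - b)))" if "P v" for v using that assms(2) by auto
  have n: "P (b + int n)" unfolding n_def by (rule LeastI, rule ex, rule assms(1))
  have le: "b + int n \<le> v" if "P v" for v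
  proof -
    have "n \<le> nat (v - b)" unfolding n_def by (rule Least_le, rule ex, rule that)
    then show ?thesis using assms(2)[OF that] by linarith
  qed
  have "Least P = b + int n" using n le by (rule Least_equality)
  then show "P (Least P)" "Least P \<le> w" using n le assms(1) by auto
qed

lemma decomposition_width_ge: "-1 \<le> decomposition_width T B"
  by (simp add: decomposition_width_def)

lemma pathwidth_le:
  assumes "path_dec (arcs_ends G) (verts G) k bs" "graph G" "verts G \<noteq> {}"
  shows "pathwidth G \<le> int k - 1"
proof -
  let ?T = "path_nat (length bs)"
  have "pathwidth G \<le> decomposition_width (with_proj ?T) ((!) bs)"
    unfolding pathwidth_def
  proof (rule Least_int_bounded(2)[where b = "-1"])
    show "\<exists>(T :: nat pair_pre_digraph) B. path_decomposition G (with_proj T) B \<and>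
        decomposition_width (with_proj ?T) ((!) bs) = decomposition_width (with_proj T) B"
      using path_decomposition_of_path_dec(1)[OF assms] by (intro exI[of _ ?T] exI[of _ "(!) bs"]) simp
  qed (auto simp: decomposition_width_ge)
  then show ?thesis using path_decomposition_of_path_dec(2)[OF assms] by simp
qed

lemma treewidth_attained:
  assumes "graph G" "verts G \<noteq> {}"
  obtains T :: "nat pair_pre_digraph" and B where "tree_decomposition G (with_proj T) B"
    "decomposition_width (with_proj T) B = treewidth G"
proof -
  interpret graph G by fact
  \<comment> \<open>The single bag \<open>verts G\<close> shows that the minimum defining the
    treewidth is over a nonempty set.\<close>
  have "path_dec (arcs_ends G) (verts G) (card (verts G)) [verts G]"
    by (auto simp: path_dec_def covers_def)
  note triv = path_decomposition_of_path_dec(1)[OF this assms]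
  have "\<exists>(T :: nat pair_pre_digraph) B. tree_decomposition G (with_proj T) B \<and>
      treewidth G = decomposition_width (with_proj T) B"
    unfolding treewidth_def
  proof (rule Least_int_bounded(1)[where b = "-1"])
    let ?T = "path_nat (length [verts G])" and ?B = "(!) [verts G]"
    show "\<exists>(T :: nat pair_pre_digraph) B. tree_decomposition G (with_proj T) B \<and>
        decomposition_width (with_proj ?T) ?B = decomposition_width (with_proj T) B"
      using triv unfolding path_decomposition_def by (intro exI[of _ ?T] exI[of _ ?B]) simp
  qed (auto simp: decomposition_width_ge)
  then show ?thesis using that by metis
qed

theorem theorem7:
  fixes G :: "('a, 'b) pre_digraph" and t h :: nat
  assumes "t \<ge> 1"
    and "graph G" and "connected G"
    and "treewidth G \<le> int t - 1"
  shows "pathwidth G \<le> int (t * h + 1) \<or> G \<in> T_class (h + 1)"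
proof (cases "ternary (arcs_ends G) (Suc h) (verts G)")
  case True
  interpret graph G by fact
  have "G \<restriction> verts G = G" by (rule pre_digraph.equality) auto
  then show ?thesis using ternary_imp_T_class[OF assms(2) True] by simp
next
  case False
  interpret graph G by fact
  have conn: "connected_in (arcs_ends G) (verts G)"
    using assms(2,3) by (simp add: connected_iff_connected_in)
  then have ne: "verts G \<noteq> {}" by (simp add: connected_in_def)
  obtain T :: "nat pair_pre_digraph" and B where T: "tree_decomposition G (with_proj T) B"
    "decomposition_width (with_proj T) B = treewidth G"
    using treewidth_attained[OF assms(2) ne] .
  \<comment> \<open>Finiteness makes the \<open>Max\<close> in the width a genuine bound on every
    bag.\<close>
  have "finite (pverts T)"
    using T(1) by (auto simp: tree_decomposition_def undirected_tree_def
        dest!: graph.axioms(1) digraph.axioms(1) fin_digraph.finite_verts)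
  moreover have "Max ((\<lambda>x. card (B x)) ` pverts T) \<le> t"
    using T(2) assms(4) by (simp add: decomposition_width_def)
  ultimately have "card (B x) \<le> t" if "x \<in> verts (with_proj T)" for x
    using that by (metis Max_ge dual_order.trans finite_imageI imageI with_proj_simps(1))
  then obtain R where "tree_dec (arcs_ends G) (verts G) t R"
    using tree_dec_of_tree_decomposition[OF assms(2) T(1)] by blast
  moreover have "sym (arcs_ends G)" using sym_arcs by (simp add: symmetric_def)
  ultimately obtain bs where "path_dec (arcs_ends G) (verts G) (t * h + 2) bs"
    using path_dec_or_ternary[OF _ finite_verts conn _ False] by blast
  \<comment> \<open>Bags of size at most \<open>t * h + 2\<close> mean width at most
    \<open>t * h + 1\<close>.\<close>
  from pathwidth_le[OF this assms(2) ne] show ?thesis by simp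
qed

end
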